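(* Let $k$ be a field of characteristic $0$. The generic symmetric quartic form in $n$ variables over $k$ has Waring rank at most $\binom{n+1}{2}+1=\binom{n+2}{2}-n$, and the generic symmetric quintic form in $n$ variables over $k$ has Waring rank at most $\binom{n+2}{2}$.
   Context: A form in $k[X_1,\dots,X_n]$ is symmetric if it is invariant under all permutations of the variables $X_1,\dots,X_n$. "Generic" refers to the forms in a nonempty Zariski open subset of the space of symmetric forms of the given degree. The Waring rank of a form $F$ of degree $m$ is the smallest $r$ such that $F$ can be written as $L_1^m+\cdots+L_r^m$ for linear forms $L_1,\dots,L_r$.
   Formalization: The Waring rank of a form over k is taken over an algebraically closed field containing k; with linear forms over k itself the quartic claim fails, e.g. for k = ℝ, n = 1, since aX⁴ with a < 0 is not a sum of fourth powers. *)

theory Defs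
  imports
    "HOL-Library.Poly_Mapping"
    "HOL-Library.Extended_Nat"
    "HOL-Combinatorics.Permutations"
    "HOL-Computational_Algebra.Polynomial"
begin

text \<open>
  A polynomial with indeterminates \<open>X\<^sub>v\<close>, \<open>v :: 'v\<close>, is a finitely supported map from monomials
  (exponent vectors) to coefficients. The ring structure is the convolution product on
  \<open>poly_mapping\<close>.
\<close>

type_synonym 'v monomial = "'v \<Rightarrow>\<^sub>0 nat"
type_synonym ('v, 'a) mpoly = "'v monomial \<Rightarrow>\<^sub>0 'a"

definition monomial_degree :: "'v monomial \<Rightarrow> nat" where
  "monomial_degree t = (\<Sum>v\<in>Poly_Mapping.keys t. Poly_Mapping.lookup t v)"

definition mpoly_eval :: "('v, 'a::comm_semiring_1) mpoly \<Rightarrow> ('v \<Rightarrow> 'a) \<Rightarrow> 'a" where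
  "mpoly_eval P x =
     (\<Sum>t\<in>Poly_Mapping.keys P. Poly_Mapping.lookup P t *
        (\<Prod>v\<in>Poly_Mapping.keys t. x v ^ Poly_Mapping.lookup t v))"

text \<open>Forms of degree \<open>m\<close> in \<open>X\<^sub>1, \<dots>, X\<^sub>n\<close>, including the zero form.\<close>

definition forms :: "nat \<Rightarrow> nat \<Rightarrow> (nat, 'a::zero) mpoly set" where
  "forms n m = {F. \<forall>t\<in>Poly_Mapping.keys F.
     Poly_Mapping.keys t \<subseteq> {1..n} \<and> monomial_degree t = m}"

text \<open>
  For a bijection \<open>\<pi>\<close> this is the substitution \<open>X\<^sub>i \<mapsto> X\<^bsub>\<pi>(i)\<^esub>\<close>: the coefficient of the result at
  an exponent vector \<open>t\<close> is the coefficient of \<open>F\<close> at \<open>t \<circ> \<pi>\<close>.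
\<close>

definition permute_vars :: "('v \<Rightarrow> 'v) \<Rightarrow> ('v, 'a::zero) mpoly \<Rightarrow> ('v, 'a) mpoly" where
  "permute_vars \<pi> F = Poly_Mapping.map_key (Poly_Mapping.map_key \<pi>) F"

definition symmetric_forms :: "nat \<Rightarrow> nat \<Rightarrow> (nat, 'a::zero) mpoly set" where
  "symmetric_forms n m = {F \<in> forms n m. \<forall>\<pi>. \<pi> permutes {1..n} \<longrightarrow> permute_vars \<pi> F = F}"

text \<open>
  Zariski open subsets of a linear space \<open>V\<close> of polynomials: complements in \<open>V\<close> of the common
  zero locus of a family of polynomials in the coefficients of \<open>F \<in> V\<close>. The indeterminates of
  these polynomials are indexed by the monomials of \<open>F\<close>.
\<close>

definition zariski_open_in ::
  "('v, 'a::comm_semiring_1) mpoly set \<Rightarrow> ('v, 'a) mpoly set \<Rightarrow> bool" where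
  "zariski_open_in V U \<longleftrightarrow>
     (\<exists>\<P> :: ('v monomial, 'a) mpoly set.
        U = V - {F \<in> V. \<forall>P\<in>\<P>. mpoly_eval P (Poly_Mapping.lookup F) = 0})"

definition generic_in ::
  "('v, 'a::comm_semiring_1) mpoly set \<Rightarrow> (('v, 'a) mpoly \<Rightarrow> bool) \<Rightarrow> bool" where
  "generic_in V Q \<longleftrightarrow> (\<exists>U. zariski_open_in V U \<and> U \<noteq> {} \<and> (\<forall>F\<in>U. Q F))"

text \<open>
  The value is \<open>\<infinity>\<close> if \<open>F\<close> is not a sum of \<open>m\<close>-th powers of linear forms with coefficients in the
  coefficient field of \<open>F\<close>.
\<close>

definition waring_rank :: "nat \<Rightarrow> nat \<Rightarrow> (nat, 'a::comm_semiring_1) mpoly \<Rightarrow> enat" where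
  "waring_rank n m F =
     (INF r \<in> {r. \<exists>L. (\<forall>i<r. L i \<in> forms n 1) \<and> F = (\<Sum>i<r. L i ^ m)}. enat r)"

text \<open>
  Extension of scalars along an embedding \<open>\<iota>\<close> of fields. Over a field that is not algebraically
  closed, the general symmetric form need not be a sum of powers of linear forms at all (such as
  \<open>-X\<^sub>1\<^sup>4\<close> over the reals), so ranks are taken after passing to an algebraically closed extension;
  for an algebraically closed field one can take \<open>\<iota> = id\<close>.
\<close>

definition extend_scalars :: "('a::zero \<Rightarrow> 'b::zero) \<Rightarrow> ('v, 'a) mpoly \<Rightarrow> ('v, 'b) mpoly" where
  "extend_scalars \<iota> F = Poly_Mapping.map \<iota> F"

definition field_embedding :: "('a::field \<Rightarrow> 'b::field) \<Rightarrow> bool" where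
  "field_embedding \<iota> \<longleftrightarrow> \<iota> 1 = 1 \<and>
     (\<forall>x y. \<iota> (x + y) = \<iota> x + \<iota> y) \<and> (\<forall>x y. \<iota> (x * y) = \<iota> x * \<iota> y)"

end

theory Submission
  imports Defs
begin

text \<open>
  Averaging over all permutations of the variables shows that the symmetric forms of degree \<open>m\<close> are
  spanned by the products of power sums \<open>p\<^sub>k = \<Sum> X\<^sub>i\<^sup>k\<close> of total degree \<open>m\<close>, and that the coordinates
  can be chosen linearly in the coefficients of the form. A nonempty open condition on the coordinates
  is therefore generic, and it remains to treat
  \<open>A p\<^sub>4 + 4 B p\<^sub>1 p\<^sub>3 + 3 C p\<^sub>2\<^sup>2 + 6 D p\<^sub>1\<^sup>2 p\<^sub>2 + E p\<^sub>1\<^sup>4\<close> and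
  \<open>A p\<^sub>5 + 5 B p\<^sub>1 p\<^sub>4 + 10 Q p\<^sub>2 p\<^sub>3 + 10 G p\<^sub>1\<^sup>2 p\<^sub>3 + 15 R p\<^sub>1 p\<^sub>2\<^sup>2 + 10 H p\<^sub>1\<^sup>3 p\<^sub>2 + E p\<^sub>1\<^sup>5\<close>.

  Quartics are matched with
  \<open>w \<Sum>\<^sub>i (X\<^sub>i + s p\<^sub>1)\<^sup>4 + C \<Sum>\<^bsub>i<j\<^esub> (X\<^sub>i + X\<^sub>j + t p\<^sub>1)\<^sup>4 + u p\<^sub>1\<^sup>4\<close>, which has
  \<open>n + (n choose 2) + 1\<close> terms. Here \<open>A\<close> determines \<open>w\<close>, \<open>B\<close> determines \<open>s\<close> linearly in terms of \<open>t\<close>,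
  \<open>D\<close> becomes a quadratic equation for \<open>t\<close>, and \<open>u\<close> absorbs \<open>E\<close>. Quintics need a second orbit
  \<open>w' \<Sum>\<^sub>i (X\<^sub>i + s' p\<^sub>1)\<^sup>5\<close>: \<open>Q\<close> and \<open>R\<close> determine the sum over the pairs \<open>i < j\<close>, and Sylvester's
  method for binary cubics then finds the two orbits from \<open>A, B, G, H\<close>.
\<close>

section \<open>Ring homomorphisms of polynomials\<close>

locale comm_ring_1_hom = additive h for h :: "'a::comm_ring_1 \<Rightarrow> 'b::comm_ring_1" +
  assumes mult: "h (x * y) = h x * h y"
    and one: "h 1 = 1"
begin

lemma power: "h (x ^ k) = h x ^ k"
  by (induction k) (simp_all add: one mult)

lemma prod: "h (\<Prod>i\<in>I. g i) = (\<Prod>i\<in>I. h (g i))"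
  by (induction I rule: infinite_finite_induct) (simp_all add: one mult)

lemma prod_list_map: "h (\<Prod>i\<leftarrow>xs. g i) = (\<Prod>i\<leftarrow>xs. h (g i))"
  by (induction xs) (simp_all add: one mult)

lemma of_nat: "h (of_nat k) = of_nat k"
  by (induction k) (simp_all add: zero one add)

lemma numeral: "h (numeral k) = numeral k"
  using of_nat[of "numeral k"] by simp

end

lemma comm_ring_1_hom_eq_0_iff:
  fixes h :: "'a::field \<Rightarrow> 'b::comm_ring_1"
  assumes "comm_ring_1_hom h"
  shows "h x = 0 \<longleftrightarrow> x = 0"
proof -
  interpret comm_ring_1_hom h by fact
  have "x = 0" if "h x = 0"
  proof (rule ccontr)
    assume "x \<noteq> 0"
    then have "h x * h (inverse x) = 1"
      by (simp add: one flip: mult)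
    with that show False by simp
  qed
  then show ?thesis
    by (auto simp: zero)
qed

lemma mpoly_eq_sum_single:
  "P = (\<Sum>t\<in>Poly_Mapping.keys P. Poly_Mapping.single t (Poly_Mapping.lookup P t))"
  by (rule poly_mapping_eqI) (simp add: lookup_sum lookup_single when_def in_keys_iff)

lemma comm_ring_1_hom_mpolyI:
  fixes h :: "('v, 'a::comm_ring_1) mpoly \<Rightarrow> 'b::comm_ring_1"
  assumes add: "\<And>P Q. h (P + Q) = h P + h Q"
    and single: "\<And>s t a b. h (Poly_Mapping.single (s + t) (a * b)) =
      h (Poly_Mapping.single s a) * h (Poly_Mapping.single t b)"
    and one: "h 1 = 1"
  shows "comm_ring_1_hom h"
proof
  interpret additive h by standard (rule add)
  show "h (P * Q) = h P * h Q" for P Q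
  proof -
    let ?term = "\<lambda>P t. Poly_Mapping.single t (Poly_Mapping.lookup P t)"
    have "h (P * Q) =
      h ((\<Sum>s\<in>Poly_Mapping.keys P. ?term P s) * (\<Sum>t\<in>Poly_Mapping.keys Q. ?term Q t))"
      by (simp flip: mpoly_eq_sum_single)
    also have "\<dots> =
      h (\<Sum>s\<in>Poly_Mapping.keys P. ?term P s) * h (\<Sum>t\<in>Poly_Mapping.keys Q. ?term Q t)"
      by (simp add: sum_product sum mult_single flip: single)
    finally show ?thesis by (simp flip: mpoly_eq_sum_single)
  qed
qed (fact add, fact one)

definition mpoly_const :: "'a \<Rightarrow> ('v, 'a::zero) mpoly" where
  "mpoly_const c = Poly_Mapping.single 0 c"

definition mpoly_var :: "'v \<Rightarrow> ('v, 'a::zero_neq_one) mpoly" where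
  "mpoly_var v = Poly_Mapping.single (Poly_Mapping.single v 1) 1"

interpretation mpoly_const: comm_ring_1_hom "mpoly_const :: 'a::comm_ring_1 \<Rightarrow> ('v, 'a) mpoly"
  by standard (simp_all add: mpoly_const_def single_add mult_single)

lemma mpoly_const_fact:
  "mpoly_const (fact k) = (fact k :: ('v, 'a::{comm_ring_1, ring_char_0}) mpoly)"
  by (metis mpoly_const.of_nat of_nat_fact)

lemmas mpoly_const_eq_0_iff = comm_ring_1_hom_eq_0_iff [OF mpoly_const.comm_ring_1_hom_axioms]

lemma mpoly_var_power: "mpoly_var v ^ k = Poly_Mapping.single (Poly_Mapping.single v k) 1"
  by (induction k) (simp_all add: mpoly_var_def mult_single flip: single_add)

definition monomial_eval :: "'v monomial \<Rightarrow> ('v \<Rightarrow> 'a::comm_semiring_1) \<Rightarrow> 'a" where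
  "monomial_eval t x = (\<Prod>v\<in>Poly_Mapping.keys t. x v ^ Poly_Mapping.lookup t v)"

lemma monomial_eval_superset:
  assumes "finite S" "Poly_Mapping.keys t \<subseteq> S"
  shows "monomial_eval t x = (\<Prod>v\<in>S. x v ^ Poly_Mapping.lookup t v)"
  unfolding monomial_eval_def
  by (rule prod.mono_neutral_left) (use assms in \<open>auto simp: in_keys_iff\<close>)

lemma monomial_eval_add: "monomial_eval (s + t) x = monomial_eval s x * monomial_eval t x"
  using keys_add[of s t]
  by (simp add: monomial_eval_superset[of "Poly_Mapping.keys s \<union> Poly_Mapping.keys t"]
      lookup_add power_add prod.distrib)

lemma single_eq_const_times_monomial_eval:
  fixes c :: "'a::comm_ring_1"
  shows "Poly_Mapping.single t c = mpoly_const c * monomial_eval t mpoly_var"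
proof -
  have "(\<Prod>v\<in>V. mpoly_var v ^ Poly_Mapping.lookup t v) =
    (Poly_Mapping.single (\<Sum>v\<in>V. Poly_Mapping.single v (Poly_Mapping.lookup t v)) 1 :: ('b, 'a) mpoly)"
    for V
    by (induction V rule: infinite_finite_induct) (simp_all add: mpoly_var_power mult_single)
  then show ?thesis
    by (simp add: monomial_eval_def mpoly_const_def mult_single flip: mpoly_eq_sum_single)
qed

lemma mpoly_eval_superset:
  assumes "finite S" "Poly_Mapping.keys P \<subseteq> S"
  shows "mpoly_eval P x = (\<Sum>t\<in>S. Poly_Mapping.lookup P t * monomial_eval t x)"
  unfolding mpoly_eval_def monomial_eval_def[symmetric]
  by (rule sum.mono_neutral_left) (use assms in \<open>auto simp: in_keys_iff\<close>)

lemma mpoly_eval_single: "mpoly_eval (Poly_Mapping.single t c) x = c * monomial_eval t x"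
  by (simp add: mpoly_eval_superset[of "{t}"])

interpretation mpoly_eval: comm_ring_1_hom "\<lambda>P. mpoly_eval P x" for x :: "'v \<Rightarrow> 'a::comm_ring_1"
proof (rule comm_ring_1_hom_mpolyI)
  show "mpoly_eval (P + Q) x = mpoly_eval P x + mpoly_eval Q x" for P Q
    using keys_add[of P Q]
    by (simp add: mpoly_eval_superset[of "Poly_Mapping.keys P \<union> Poly_Mapping.keys Q"]
        lookup_add distrib_right sum.distrib)
  show "mpoly_eval (Poly_Mapping.single (s + t) (a * b)) x =
    mpoly_eval (Poly_Mapping.single s a) x * mpoly_eval (Poly_Mapping.single t b) x" for s t a b
    by (simp add: mpoly_eval_single monomial_eval_add ac_simps)
  show "mpoly_eval 1 x = 1"
    by (simp add: mpoly_eval_single monomial_eval_def flip: single_one)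
qed

section \<open>Polynomial functions and generic properties\<close>

definition polynomial_fun :: "(('v \<Rightarrow> 'a::comm_ring_1) \<Rightarrow> 'a) \<Rightarrow> bool" where
  "polynomial_fun f \<longleftrightarrow> (\<exists>P. \<forall>x. mpoly_eval P x = f x)"

named_theorems polynomial_intros

lemma polynomial_fun_const [polynomial_intros]: "polynomial_fun (\<lambda>x. c)"
  unfolding polynomial_fun_def
  by (rule exI[of _ "mpoly_const c"]) (simp add: mpoly_const_def mpoly_eval_single monomial_eval_def)

lemma polynomial_fun_var [polynomial_intros]: "polynomial_fun (\<lambda>x. x v)"
  unfolding polynomial_fun_def
  by (rule exI[of _ "mpoly_var v"]) (simp add: mpoly_var_def mpoly_eval_single monomial_eval_def)

lemma polynomial_fun_add [polynomial_intros]: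
  "polynomial_fun f \<Longrightarrow> polynomial_fun g \<Longrightarrow> polynomial_fun (\<lambda>x. f x + g x)"
  unfolding polynomial_fun_def by (metis mpoly_eval.add)

lemma polynomial_fun_diff [polynomial_intros]:
  "polynomial_fun f \<Longrightarrow> polynomial_fun g \<Longrightarrow> polynomial_fun (\<lambda>x. f x - g x)"
  unfolding polynomial_fun_def by (metis mpoly_eval.diff)

lemma polynomial_fun_mult [polynomial_intros]:
  "polynomial_fun f \<Longrightarrow> polynomial_fun g \<Longrightarrow> polynomial_fun (\<lambda>x. f x * g x)"
  unfolding polynomial_fun_def by (metis mpoly_eval.mult)

lemma polynomial_fun_power [polynomial_intros]:
  "polynomial_fun f \<Longrightarrow> polynomial_fun (\<lambda>x. f x ^ k)"
  unfolding polynomial_fun_def by (metis mpoly_eval.power)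

lemma polynomial_fun_divide [polynomial_intros]:
  fixes f :: "('v \<Rightarrow> 'a::field) \<Rightarrow> 'a"
  shows "polynomial_fun f \<Longrightarrow> polynomial_fun (\<lambda>x. f x / c)"
  unfolding divide_inverse by (intro polynomial_intros)

lemma polynomial_fun_sum [polynomial_intros]:
  assumes "\<And>i. i \<in> I \<Longrightarrow> polynomial_fun (f i)"
  shows "polynomial_fun (\<lambda>x. \<Sum>i\<in>I. f i x)"
  using assms by (induction I rule: infinite_finite_induct) (auto intro: polynomial_intros)

lemma polynomial_fun_prod [polynomial_intros]:
  assumes "\<And>i. i \<in> I \<Longrightarrow> polynomial_fun (f i)"
  shows "polynomial_fun (\<lambda>x. \<Prod>i\<in>I. f i x)"
  using assms by (induction I rule: infinite_finite_induct) (auto intro: polynomial_intros)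

lemma polynomial_fun_compose:
  assumes f: "polynomial_fun f" and g: "\<And>v. polynomial_fun (g v)"
  shows "polynomial_fun (\<lambda>x. f (\<lambda>v. g v x))"
proof -
  obtain P where "\<And>x. f x = mpoly_eval P x"
    using f unfolding polynomial_fun_def by metis
  then show ?thesis
    by (simp only: mpoly_eval_def) (intro polynomial_intros g)
qed

lemma generic_inI:
  assumes f: "polynomial_fun f" and F0: "F0 \<in> V" "f (Poly_Mapping.lookup F0) \<noteq> 0"
    and Q: "\<And>F. F \<in> V \<Longrightarrow> f (Poly_Mapping.lookup F) \<noteq> 0 \<Longrightarrow> Q F"
  shows "generic_in V Q"
proof -
  obtain P where P: "\<And>x. mpoly_eval P x = f x"
    using f unfolding polynomial_fun_def by blast
  have "zariski_open_in V {F \<in> V. f (Poly_Mapping.lookup F) \<noteq> 0}"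
    unfolding zariski_open_in_def by (rule exI[of _ "{P}"]) (auto simp: P)
  then show ?thesis
    unfolding generic_in_def using F0 Q by blast
qed

text \<open>
  The section \<open>s\<close> of \<open>\<Phi>\<close> need not map \<open>\<Phi> z\<close> to \<open>z\<close>, so it is translated by an element of the
  kernel of \<open>\<Phi>\<close> before \<open>f\<close> is pulled back along it.
\<close>

lemma generic_in_parametrizationI:
  fixes \<Phi> :: "('j \<Rightarrow> 'a::comm_ring_1) \<Rightarrow> ('v, 'a) mpoly"
  assumes \<Phi>_add: "\<And>c d. \<Phi> (\<lambda>j. c j + d j) = \<Phi> c + \<Phi> d"
    and s: "\<And>j. polynomial_fun (s j)"
    and s_section: "\<And>F. F \<in> V \<Longrightarrow> \<Phi> (\<lambda>j. s j (Poly_Mapping.lookup F)) = F"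
    and f: "polynomial_fun f" and z: "\<Phi> z \<in> V" "f z \<noteq> 0"
    and Q: "\<And>c. f c \<noteq> 0 \<Longrightarrow> Q (\<Phi> c)"
  shows "generic_in V Q"
proof (rule generic_inI)
  define k where "k j = z j - s j (Poly_Mapping.lookup (\<Phi> z))" for j
  define s' where "s' x j = s j x + k j" for x j
  have "\<Phi> z = \<Phi> z + \<Phi> k"
    using \<Phi>_add[of "\<lambda>j. s j (Poly_Mapping.lookup (\<Phi> z))" k] s_section[OF z(1)] by (simp add: k_def)
  then have "\<Phi> k = 0" by simp
  then have s'_section: "\<Phi> (s' (Poly_Mapping.lookup F)) = F" if "F \<in> V" for F
    using \<Phi>_add[of "\<lambda>j. s j (Poly_Mapping.lookup F)" k] s_section[OF that]
    by (simp add: s'_def[abs_def])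
  show "polynomial_fun (\<lambda>x. f (s' x))"
    unfolding s'_def[abs_def] by (intro polynomial_fun_compose[OF f] polynomial_intros s)
  show "\<Phi> z \<in> V" by fact
  show "f (s' (Poly_Mapping.lookup (\<Phi> z))) \<noteq> 0"
    using z(2) by (simp add: s'_def[abs_def] k_def)
  show "Q F" if "F \<in> V" "f (s' (Poly_Mapping.lookup F)) \<noteq> 0" for F
    using Q[OF that(2)] s'_section[OF that(1)] by simp
qed

section \<open>Symmetric forms\<close>

lemma monomial_degree_superset:
  assumes "finite S" "Poly_Mapping.keys t \<subseteq> S"
  shows "monomial_degree t = (\<Sum>v\<in>S. Poly_Mapping.lookup t v)"
  unfolding monomial_degree_def
  by (rule sum.mono_neutral_left) (use assms in \<open>auto simp: in_keys_iff\<close>)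

lemma monomial_degree_add: "monomial_degree (s + t) = monomial_degree s + monomial_degree t"
  using keys_add[of s t]
  by (simp add: monomial_degree_superset[of "Poly_Mapping.keys s \<union> Poly_Mapping.keys t"]
      lookup_add sum.distrib)

definition monomials :: "nat \<Rightarrow> nat \<Rightarrow> nat monomial set" where
  "monomials n m = {t. Poly_Mapping.keys t \<subseteq> {1..n} \<and> monomial_degree t = m}"

lemma finite_monomials: "finite (monomials n m)"
proof (rule finite_imageD)
  show "finite (Poly_Mapping.lookup ` monomials n m)"
  proof (rule finite_subset)
    show "finite {f. \<forall>v. (v \<in> {1..n} \<longrightarrow> f v \<in> {..m}) \<and> (v \<notin> {1..n} \<longrightarrow> f v = (0 :: nat))}"
      by (rule finite_set_of_finite_funs) simp_all
    show "Poly_Mapping.lookup ` monomials n m \<subseteq>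
      {f. \<forall>v. (v \<in> {1..n} \<longrightarrow> f v \<in> {..m}) \<and> (v \<notin> {1..n} \<longrightarrow> f v = 0)}"
    proof (rule image_subsetI, intro CollectI allI)
      fix t v assume "t \<in> monomials n m"
      then have support: "Poly_Mapping.keys t \<subseteq> {1..n}" and degree: "monomial_degree t = m"
        by (simp_all add: monomials_def)
      have "Poly_Mapping.lookup t v \<le> m"
        using member_le_sum[of v "Poly_Mapping.keys t" "Poly_Mapping.lookup t"] degree
        by (cases "v \<in> Poly_Mapping.keys t") (simp_all add: monomial_degree_def in_keys_iff)
      moreover have "Poly_Mapping.lookup t v = 0" if "v \<notin> {1..n}"
        using support that by (meson in_keys_iff subsetD)
      ultimately show "(v \<in> {1..n} \<longrightarrow> Poly_Mapping.lookup t v \<in> {..m}) \<and>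
        (v \<notin> {1..n} \<longrightarrow> Poly_Mapping.lookup t v = 0)"
        by simp
    qed
  qed
  show "inj_on Poly_Mapping.lookup (monomials n m)"
    by (simp add: inj_on_def)
qed

lemma forms_eq_sum_monomials:
  fixes F :: "(nat, 'a::comm_ring_1) mpoly"
  assumes "F \<in> forms n m"
  shows "F = (\<Sum>t\<in>monomials n m. mpoly_const (Poly_Mapping.lookup F t) * monomial_eval t mpoly_var)"
proof -
  have "(\<Sum>t\<in>Poly_Mapping.keys F. Poly_Mapping.single t (Poly_Mapping.lookup F t)) =
    (\<Sum>t\<in>monomials n m. Poly_Mapping.single t (Poly_Mapping.lookup F t))"
    using assms
    by (intro sum.mono_neutral_left finite_monomials) (auto simp: forms_def monomials_def in_keys_iff)
  then show ?thesis
    by (simp flip: mpoly_eq_sum_single single_eq_const_times_monomial_eval)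
qed

lemma forms_add: "F \<in> forms n m \<Longrightarrow> G \<in> forms n m \<Longrightarrow> F + G \<in> forms n m"
  using keys_add[of F G] unfolding forms_def by blast

lemma forms_sum: "(\<And>i. i \<in> I \<Longrightarrow> F i \<in> forms n m) \<Longrightarrow> (\<Sum>i\<in>I. F i) \<in> forms n m"
  by (induction I rule: infinite_finite_induct) (auto simp: forms_add, auto simp: forms_def)

lemma forms_mult:
  assumes "F \<in> forms n k" "G \<in> forms n m"
  shows "F * G \<in> forms n (k + m)"
  unfolding forms_def
proof (intro CollectI ballI)
  fix t assume "t \<in> Poly_Mapping.keys (F * G)"
  then obtain r s where "t = r + s" "r \<in> Poly_Mapping.keys F" "s \<in> Poly_Mapping.keys G"
    using keys_mult[of F G] by blast
  then show "Poly_Mapping.keys t \<subseteq> {1..n} \<and> monomial_degree t = k + m"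
    using assms keys_add[of r s] by (fastforce simp: forms_def monomial_degree_add)
qed

lemma mpoly_const_in_forms: "mpoly_const c \<in> forms n 0"
  by (simp add: forms_def mpoly_const_def monomial_degree_def)

lemma mpoly_var_power_in_forms:
  "i \<in> {1..n} \<Longrightarrow> (mpoly_var i ^ k :: (nat, 'a::comm_ring_1) mpoly) \<in> forms n k"
  by (simp add: forms_def mpoly_var_power monomial_degree_def)

lemma inj_map_key:
  assumes "bij \<pi>"
  shows "inj (Poly_Mapping.map_key \<pi>)"
proof (rule injI)
  fix s t :: "'b \<Rightarrow>\<^sub>0 'c::zero"
  assume "Poly_Mapping.map_key \<pi> s = Poly_Mapping.map_key \<pi> t"
  then have "Poly_Mapping.lookup s \<circ> \<pi> = Poly_Mapping.lookup t \<circ> \<pi>"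
    using bij_is_inj[OF assms] by (metis map_key.rep_eq)
  then show "s = t"
    using bij_is_surj[OF assms] by (metis lookup_inject surj_fun_eq)
qed

lemma map_key_inv:
  assumes "bij \<pi>"
  shows "Poly_Mapping.map_key \<pi> (Poly_Mapping.map_key (inv \<pi>) t) = t"
  using assms
  by (simp add: map_key_compose bij_is_inj bij_imp_bij_inv bij_is_surj surj_imp_inv_eq o_def
      map_key_id inv_f_f)

lemma permute_vars_single:
  assumes "bij \<pi>"
  shows "permute_vars \<pi> (Poly_Mapping.single (Poly_Mapping.map_key \<pi> t) c) = Poly_Mapping.single t c"
  unfolding permute_vars_def by (rule map_key_single[OF inj_map_key[OF assms]])

lemma permute_vars_const:
  "bij \<pi> \<Longrightarrow> permute_vars \<pi> (mpoly_const c) = mpoly_const c"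
  using permute_vars_single[of \<pi> 0 c] by (simp add: mpoly_const_def bij_is_inj)

lemma permute_vars_var:
  "bij \<pi> \<Longrightarrow> permute_vars \<pi> (mpoly_var v) = mpoly_var (\<pi> v)"
  using permute_vars_single[of \<pi> "Poly_Mapping.single (\<pi> v) 1" 1]
  by (simp add: mpoly_var_def bij_is_inj)

lemma comm_ring_1_hom_permute_vars:
  assumes "bij \<pi>"
  shows "comm_ring_1_hom (permute_vars \<pi> :: ('v, 'a::comm_ring_1) mpoly \<Rightarrow> ('v, 'a) mpoly)"
proof (rule comm_ring_1_hom_mpolyI)
  show "permute_vars \<pi> (P + Q) = permute_vars \<pi> P + permute_vars \<pi> Q"
    for P Q :: "('v, 'a) mpoly"
    unfolding permute_vars_def by (rule map_key_plus[OF inj_map_key[OF assms]])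
  show "permute_vars \<pi> (Poly_Mapping.single (s + t) (a * b)) =
    permute_vars \<pi> (Poly_Mapping.single s a) * permute_vars \<pi> (Poly_Mapping.single t b)"
    for s t :: "'v monomial" and a b :: 'a
  proof -
    have permute_single: "permute_vars \<pi> (Poly_Mapping.single r c) =
      Poly_Mapping.single (Poly_Mapping.map_key (inv \<pi>) r) c" for r :: "'v monomial" and c :: 'a
      using permute_vars_single[OF assms, of "Poly_Mapping.map_key (inv \<pi>) r" c]
      by (simp add: map_key_inv[OF assms])
    show ?thesis
      using bij_is_inj[OF bij_imp_bij_inv[OF assms]]
        by (simp add: permute_single mult_single map_key_plus)
  qed
  show "permute_vars \<pi> 1 = (1 :: ('v, 'a) mpoly)"
    using permute_vars_const[OF assms, of "1 :: 'a"] by (simp add: mpoly_const.one)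
qed

lemmas permute_vars_sum =
    additive.sum [OF comm_ring_1_hom.axioms(1) [OF comm_ring_1_hom_permute_vars]]
  and permute_vars_mult = comm_ring_1_hom.mult [OF comm_ring_1_hom_permute_vars]
  and permute_vars_power = comm_ring_1_hom.power [OF comm_ring_1_hom_permute_vars]
  and permute_vars_prod = comm_ring_1_hom.prod [OF comm_ring_1_hom_permute_vars]

lemma symmetric_forms_mult:
  fixes F G :: "(nat, 'a::comm_ring_1) mpoly"
  assumes "F \<in> symmetric_forms n k" "G \<in> symmetric_forms n m"
  shows "F * G \<in> symmetric_forms n (k + m)"
  using assms by (simp add: symmetric_forms_def forms_mult permute_vars_mult permutes_bij)

lemma symmetric_forms_sum:
  fixes F :: "'i \<Rightarrow> (nat, 'a::comm_ring_1) mpoly"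
  assumes "\<And>i. i \<in> I \<Longrightarrow> F i \<in> symmetric_forms n m"
  shows "(\<Sum>i\<in>I. F i) \<in> symmetric_forms n m"
  using assms by (simp add: symmetric_forms_def forms_sum permute_vars_sum permutes_bij)

lemma mpoly_const_symmetric: "(mpoly_const c :: (nat, 'a::comm_ring_1) mpoly) \<in> symmetric_forms n 0"
  by (simp add: symmetric_forms_def mpoly_const_in_forms permute_vars_const permutes_bij)

definition power_sum :: "('i \<Rightarrow> 'a::comm_semiring_1) \<Rightarrow> 'i set \<Rightarrow> nat \<Rightarrow> 'a" where
  "power_sum x I k = (\<Sum>i\<in>I. x i ^ k)"

abbreviation power_sum_form :: "nat \<Rightarrow> nat \<Rightarrow> (nat, 'a::comm_ring_1) mpoly" where
  "power_sum_form n \<equiv> power_sum mpoly_var {1..n}"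

definition power_sum_product :: "nat \<Rightarrow> nat list \<Rightarrow> (nat, 'a::comm_ring_1) mpoly" where
  "power_sum_product n ks = (\<Prod>k\<leftarrow>ks. power_sum_form n k)"

lemma power_sum_symmetric:
  "(power_sum_form n k :: (nat, 'a::comm_ring_1) mpoly) \<in> symmetric_forms n k" (is "?p \<in> _")
proof -
  have "permute_vars \<pi> ?p = ?p" if "\<pi> permutes {1..n}" for \<pi>
  proof -
    have "permute_vars \<pi> ?p = (\<Sum>i\<in>{1..n}. mpoly_var (\<pi> i) ^ k)"
      using permutes_bij[OF that]
      by (simp add: power_sum_def permute_vars_sum permute_vars_power permute_vars_var)
    also have "\<dots> = ?p"
      unfolding power_sum_def
      by (rule sum.permute[OF that, of "\<lambda>i. mpoly_var i ^ k", unfolded o_def, symmetric])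
    finally show ?thesis .
  qed
  moreover have "?p \<in> forms n k"
    unfolding power_sum_def by (intro forms_sum mpoly_var_power_in_forms)
  ultimately show ?thesis
    by (simp add: symmetric_forms_def)
qed

lemma power_sum_product_symmetric: "power_sum_product n ks \<in> symmetric_forms n (sum_list ks)"
proof (induction ks)
  case Nil
  show ?case
    using mpoly_const_symmetric[of 1 n] by (simp add: power_sum_product_def mpoly_const.one)
next
  case (Cons k ks)
  then show ?case
    using symmetric_forms_mult[OF power_sum_symmetric Cons] by (simp add: power_sum_product_def)
qed

lemma comm_ring_1_hom_field_embedding:
  assumes "field_embedding \<iota>"
  shows "comm_ring_1_hom \<iota>"
  by standard (use assms in \<open>auto simp: field_embedding_def\<close>)

lemma lookup_extend_scalars:
  "\<iota> 0 = 0 \<Longrightarrow> Poly_Mapping.lookup (extend_scalars \<iota> P) t = \<iota> (Poly_Mapping.lookup P t)"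
  by (simp add: extend_scalars_def Poly_Mapping.map.rep_eq when_def)

lemma extend_scalars_single:
  "\<iota> 0 = 0 \<Longrightarrow> extend_scalars \<iota> (Poly_Mapping.single t c) = Poly_Mapping.single t (\<iota> c)"
  by (simp add: extend_scalars_def)

lemma comm_ring_1_hom_extend_scalars:
  assumes "comm_ring_1_hom \<iota>"
  shows "comm_ring_1_hom (extend_scalars \<iota> :: ('v, _) mpoly \<Rightarrow> _)"
proof -
  interpret comm_ring_1_hom \<iota> by fact
  show ?thesis
  proof (rule comm_ring_1_hom_mpolyI)
    show "extend_scalars \<iota> (P + Q) = extend_scalars \<iota> P + extend_scalars \<iota> Q"
      for P Q :: "('v, _) mpoly"
      by (rule poly_mapping_eqI) (simp add: lookup_extend_scalars zero lookup_add add)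
    show "extend_scalars \<iota> (Poly_Mapping.single (s + t) (a * b)) =
      extend_scalars \<iota> (Poly_Mapping.single s a) * extend_scalars \<iota> (Poly_Mapping.single t b)"
      for s t :: "'v monomial" and a b
      by (simp add: extend_scalars_single zero mult mult_single)
    show "extend_scalars \<iota> (1 :: ('v, _) mpoly) = 1"
      using extend_scalars_single[of \<iota> 0 1, OF zero] by (simp add: one)
  qed
qed

section \<open>Power sums span the symmetric forms\<close>

text \<open>Every term of the orbit of \<open>\<Prod>\<^bsub>i\<in>S\<^esub> x\<^sub>i\<^bsup>e i\<^esup>\<close> is counted with the order of its stabilizer.\<close>

definition orbit_sum ::
  "('i \<Rightarrow> 'a::comm_semiring_1) \<Rightarrow> 'i set \<Rightarrow> 'i set \<Rightarrow> ('i \<Rightarrow> nat) \<Rightarrow> 'a" where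
  "orbit_sum x I S e = (\<Sum>\<pi> | \<pi> permutes I. \<Prod>i\<in>S. x (\<pi> i) ^ e i)"

abbreviation orbit_form :: "nat \<Rightarrow> nat monomial \<Rightarrow> (nat, 'a::comm_ring_1) mpoly" where
  "orbit_form n t \<equiv> orbit_sum mpoly_var {1..n} (Poly_Mapping.keys t) (Poly_Mapping.lookup t)"

lemma orbit_sum_empty: "finite I \<Longrightarrow> orbit_sum x I {} e = fact (card I)"
  by (simp add: orbit_sum_def card_permutations[OF refl])

lemma power_sum_times_orbit_sum:
  "power_sum x I k * orbit_sum x I S e =
    (\<Sum>i\<in>I. \<Sum>\<pi> | \<pi> permutes I. x (\<pi> i) ^ k * (\<Prod>l\<in>S. x (\<pi> l) ^ e l))"
proof -
  have "power_sum x I k * orbit_sum x I S e =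
    (\<Sum>\<pi> | \<pi> permutes I. \<Sum>i\<in>I. x (\<pi> i) ^ k * (\<Prod>l\<in>S. x (\<pi> l) ^ e l))"
    unfolding orbit_sum_def sum_distrib_left
  proof (rule sum.cong[OF refl])
    fix \<pi> assume "\<pi> \<in> {\<pi>. \<pi> permutes I}"
    then have "power_sum x I k = (\<Sum>i\<in>I. x (\<pi> i) ^ k)"
      using sum.permute[of \<pi> I "\<lambda>i. x i ^ k"] by (simp add: power_sum_def o_def)
    then show "power_sum x I k * (\<Prod>l\<in>S. x (\<pi> l) ^ e l) =
      (\<Sum>i\<in>I. x (\<pi> i) ^ k * (\<Prod>l\<in>S. x (\<pi> l) ^ e l))"
      by (simp add: sum_distrib_right)
  qed
  also have "\<dots> = (\<Sum>i\<in>I. \<Sum>\<pi> | \<pi> permutes I. x (\<pi> i) ^ k * (\<Prod>l\<in>S. x (\<pi> l) ^ e l))"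
    by (rule sum.swap)
  finally show ?thesis .
qed

lemma sum_permutations_eq_orbit_sum_fun_upd:
  assumes "finite S" "i \<in> S"
  shows "(\<Sum>\<pi> | \<pi> permutes I. x (\<pi> i) ^ k * (\<Prod>l\<in>S. x (\<pi> l) ^ e l)) =
    orbit_sum x I S (e(i := e i + k))"
  unfolding orbit_sum_def prod.remove[OF assms]
  by (intro sum.cong refl) (simp add: power_add algebra_simps)

lemma sum_permutations_eq_orbit_sum_insert:
  assumes "finite S" "i \<in> I - S" "j \<in> I - S"
  shows "(\<Sum>\<pi> | \<pi> permutes I. x (\<pi> i) ^ e j * (\<Prod>l\<in>S. x (\<pi> l) ^ e l)) =
    orbit_sum x I (insert j S) e"
proof -
  let ?\<tau> = "transpose i j"
  have "(\<Sum>\<pi> | \<pi> permutes I. x (\<pi> i) ^ e j * (\<Prod>l\<in>S. x (\<pi> l) ^ e l)) =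
    (\<Sum>\<pi> | \<pi> permutes I. x ((\<pi> \<circ> ?\<tau>) i) ^ e j * (\<Prod>l\<in>S. x ((\<pi> \<circ> ?\<tau>) l) ^ e l))"
    by (rule sum_permutations_compose_right) (use assms in \<open>auto intro: permutes_swap_id\<close>)
  also have "\<dots> = (\<Sum>\<pi> | \<pi> permutes I. x (\<pi> j) ^ e j * (\<Prod>l\<in>S. x (\<pi> l) ^ e l))"
  proof (rule sum.cong[OF refl])
    fix \<pi>
    have "(\<Prod>l\<in>S. x ((\<pi> \<circ> ?\<tau>) l) ^ e l) = (\<Prod>l\<in>S. x (\<pi> l) ^ e l)"
      by (rule prod.cong) (use assms in \<open>auto simp: transpose_def\<close>)
    then show "x ((\<pi> \<circ> ?\<tau>) i) ^ e j * (\<Prod>l\<in>S. x ((\<pi> \<circ> ?\<tau>) l) ^ e l) =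
      x (\<pi> j) ^ e j * (\<Prod>l\<in>S. x (\<pi> l) ^ e l)"
      by simp
  qed
  finally show ?thesis
    using assms by (simp add: orbit_sum_def)
qed

lemma orbit_sum_insert:
  fixes x :: "'i \<Rightarrow> 'a::comm_ring_1"
  assumes I: "finite I" and S: "S \<subseteq> I" and j: "j \<in> I - S"
  shows "of_nat (card I - card S) * orbit_sum x I (insert j S) e =
    power_sum x I (e j) * orbit_sum x I S e - (\<Sum>i\<in>S. orbit_sum x I S (e(i := e i + e j)))"
proof -
  let ?T = "\<lambda>i. \<Sum>\<pi> | \<pi> permutes I. x (\<pi> i) ^ e j * (\<Prod>l\<in>S. x (\<pi> l) ^ e l)"
  have finite_S: "finite S" using S I by (rule finite_subset)
  have "power_sum x I (e j) * orbit_sum x I S e = (\<Sum>i\<in>I - S. ?T i) + (\<Sum>i\<in>S. ?T i)"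
    unfolding power_sum_times_orbit_sum by (rule sum.subset_diff[OF S I])
  also have "(\<Sum>i\<in>I - S. ?T i) = of_nat (card I - card S) * orbit_sum x I (insert j S) e"
    using j finite_S S by (simp add: sum_permutations_eq_orbit_sum_insert card_Diff_subset)
  also have "(\<Sum>i\<in>S. ?T i) = (\<Sum>i\<in>S. orbit_sum x I S (e(i := e i + e j)))"
    by (intro sum.cong refl sum_permutations_eq_orbit_sum_fun_upd finite_S)
  finally show ?thesis
    by simp
qed

lemma symmetric_form_eq_sum_orbit_form:
  fixes F :: "(nat, 'a::field_char_0) mpoly"
  assumes F: "F \<in> symmetric_forms n m"
  shows "F = (\<Sum>t\<in>monomials n m. mpoly_const (Poly_Mapping.lookup F t / fact n) * orbit_form n t)"
proof -
  have F_eq: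
    "F = (\<Sum>t\<in>monomials n m. mpoly_const (Poly_Mapping.lookup F t) * monomial_eval t mpoly_var)"
    using F unfolding symmetric_forms_def by (blast intro: forms_eq_sum_monomials)
  have "F = (\<Sum>t\<in>monomials n m. mpoly_const (Poly_Mapping.lookup F t) *
    monomial_eval t (\<lambda>i. mpoly_var (\<pi> i)))" if \<pi>: "\<pi> permutes {1..n}" for \<pi>
  proof -
    have "F = permute_vars \<pi> F"
      using F \<pi> by (simp add: symmetric_forms_def)
    also have "\<dots> = permute_vars \<pi>
      (\<Sum>t\<in>monomials n m. mpoly_const (Poly_Mapping.lookup F t) * monomial_eval t mpoly_var)"
      by (simp flip: F_eq)
    finally show ?thesis
      using permutes_bij[OF \<pi>]
      by (simp add: monomial_eval_def permute_vars_sum permute_vars_mult permute_vars_prod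
          permute_vars_power permute_vars_const permute_vars_var)
  qed
  then have "(\<Sum>\<pi> | \<pi> permutes {1..n}. F) =
    (\<Sum>t\<in>monomials n m. mpoly_const (Poly_Mapping.lookup F t) * orbit_form n t)"
    unfolding orbit_sum_def sum_distrib_left monomial_eval_def
    by (subst sum.swap) (rule sum.cong; simp)
  then have "mpoly_const (1 / fact n) * (mpoly_const (fact n) * F) = mpoly_const (1 / fact n) *
    (\<Sum>t\<in>monomials n m. mpoly_const (Poly_Mapping.lookup F t) * orbit_form n t)"
    by (simp add: card_permutations[OF refl] mpoly_const_fact)
  then show ?thesis
    by (simp add: sum_distrib_left mpoly_const.one flip: mult.assoc mpoly_const.mult)
qed

definition partitions :: "nat \<Rightarrow> nat \<Rightarrow> nat list set" where
  "partitions l m = {ks. sorted ks \<and> (\<forall>k\<in>set ks. l \<le> k) \<and> sum_list ks = m}"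

lemma Nil_in_partitions_iff [simp]: "[] \<in> partitions l m \<longleftrightarrow> m = 0"
  by (auto simp: partitions_def)

lemma Cons_in_partitions_iff:
  "k # ks \<in> partitions l m \<longleftrightarrow> l \<le> k \<and> k \<le> m \<and> ks \<in> partitions k (m - k)"
  by (auto simp: partitions_def)

lemma partitions_0: "0 < l \<Longrightarrow> partitions l 0 = {[]}"
proof -
  assume "0 < l"
  then have "ks \<in> partitions l 0 \<longleftrightarrow> ks = []" for ks
    by (cases ks) (auto simp: Cons_in_partitions_iff)
  then show ?thesis by blast
qed

lemma partitions_rec:
  assumes "0 < m"
  shows "partitions l m =
    (if m < l then {} else (#) l ` partitions l (m - l) \<union> partitions (Suc l) m)"
proof -
  have "ks \<in> partitions l m \<longleftrightarrow>
    l \<le> m \<and> (ks \<in> (#) l ` partitions l (m - l) \<or> ks \<in> partitions (Suc l) m)" for ks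
    using assms by (cases ks) (auto simp: Cons_in_partitions_iff le_less Suc_le_eq)
  then show ?thesis
    by auto
qed

lemma finite_partitions: "finite (partitions 1 m)"
proof (rule finite_subset)
  have "length ks \<le> sum_list ks" if "\<forall>k\<in>set ks. 1 \<le> k" for ks :: "nat list"
    using that by (induction ks) auto
  then show "partitions 1 m \<subseteq> {ks. set ks \<subseteq> {..m} \<and> length ks \<le> m}"
    using member_le_sum_list by (force simp: partitions_def)
  show "finite {ks. set ks \<subseteq> {..m} \<and> length ks \<le> m}"
    by (rule finite_lists_length_le) simp
qed

lemma insort_partitions:
  assumes "ks \<in> partitions l m" "l \<le> k"
  shows "insort k ks \<in> partitions l (m + k)"
proof -
  have "sum_list (insort k ks) = sum_list ks + k"
    by (induction ks) simp_all
  then show ?thesis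
    using assms by (simp add: partitions_def sorted_insort set_insort_key)
qed

lemma partitions_4: "partitions 1 4 = {[4], [2, 2], [1, 3], [1, 1, 2], [1, 1, 1, 1]}"
  by (simp add: partitions_rec partitions_0 eval_nat_numeral)

lemma partitions_5: "partitions 1 5 =
    {[5], [2, 3], [1, 4], [1, 2, 2], [1, 1, 3], [1, 1, 1, 2], [1, 1, 1, 1, 1]}"
  by (simp add: partitions_rec partitions_0 eval_nat_numeral)

lemma power_sum_product_insort:
  "power_sum_product n (insort k ks) = power_sum_form n k * power_sum_product n ks"
  by (induction ks) (simp_all add: power_sum_product_def mult.left_commute)

interpretation mpoly: vector_space "\<lambda>c P. mpoly_const c * P :: ('v, 'a::field) mpoly"
  by standard
    (simp_all add: mpoly_const.add mpoly_const.mult mpoly_const.one algebra_simps)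

abbreviation power_sum_span :: "nat \<Rightarrow> nat \<Rightarrow> (nat, 'a::field) mpoly set" where
  "power_sum_span n m \<equiv> mpoly.span (power_sum_product n ` partitions 1 m)"

lemma power_sum_span_mult:
  assumes "0 < k" "P \<in> power_sum_span n m"
  shows "power_sum_form n k * P \<in> power_sum_span n (m + k)"
  using assms(2)
proof (induction rule: mpoly.span_induct_alt)
  case base
  show ?case
    by (simp add: mpoly.span_zero)
next
  case (step c P Q)
  then obtain ks where ks: "ks \<in> partitions 1 m" "P = power_sum_product n ks"
    by blast
  have "power_sum_product n (insort k ks) \<in> power_sum_span n (m + k)"
    by (intro mpoly.span_base imageI insort_partitions) (use ks assms(1) in simp_all)
  then have "power_sum_form n k * P \<in> power_sum_span n (m + k)"
    by (simp only: ks(2) power_sum_product_insort)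
  then have "mpoly_const c * (power_sum_form n k * P) + power_sum_form n k * Q
    \<in> power_sum_span n (m + k)"
    by (intro mpoly.span_add mpoly.span_scale step)
  then show ?case
    by (simp only: distrib_left mult.left_commute)
qed

lemma orbit_sum_in_power_sum_span:
  assumes "S \<subseteq> {1..n}" "\<And>i. i \<in> S \<Longrightarrow> 0 < e i"
  shows "(orbit_sum mpoly_var {1..n} S e :: (nat, 'a::field_char_0) mpoly)
    \<in> power_sum_span n (sum e S)"
  using finite_subset[OF assms(1) finite_atLeastAtMost] assms
proof (induction S arbitrary: e rule: finite_induct)
  case empty
  have "orbit_sum mpoly_var {1..n} {} e =
    (mpoly_const (fact n) * power_sum_product n [] :: (nat, 'a) mpoly)"
    by (simp add: orbit_sum_empty power_sum_product_def mpoly_const_fact)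
  moreover have "power_sum_product n [] \<in> (power_sum_span n 0 :: (nat, 'a) mpoly set)"
    by (rule mpoly.span_base) (simp add: partitions_0)
  ultimately show ?case
    by (simp add: mpoly.span_scale)
next
  case (insert j S)
  let ?orbit_sum = "orbit_sum mpoly_var {1..n} :: nat set \<Rightarrow> (nat \<Rightarrow> nat) \<Rightarrow> (nat, 'a) mpoly"
  let ?N = "of_nat (n - card S) :: 'a"
  have S: "S \<subseteq> {1..n}" "j \<in> {1..n} - S" and positive: "0 < e j" "\<And>i. i \<in> S \<Longrightarrow> 0 < e i"
    using insert by auto
  have "card S < card {1..n}"
    by (rule psubset_card_mono) (use S in auto)
  then have N_nonzero: "?N \<noteq> 0" by simp
  have "power_sum_form n (e j) * ?orbit_sum S e \<in> power_sum_span n (sum e (insert j S))"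
    using power_sum_span_mult[OF positive(1) insert.IH[OF S(1) positive(2)]] insert.hyps
    by (simp add: add.commute)
  moreover have "?orbit_sum S (e(i := e i + e j)) \<in> power_sum_span n (sum e (insert j S))"
    if i: "i \<in> S" for i
  proof -
    have "sum (e(i := e i + e j)) S = sum e (insert j S)"
      using i insert.hyps by (simp add: sum.remove[OF insert.hyps(1) i])
    moreover have "0 < (e(i := e i + e j)) l" if "l \<in> S" for l
      using positive(1) positive(2)[OF that] by simp
    ultimately show ?thesis
      using insert.IH[OF S(1), of "e(i := e i + e j)"] by (simp only:)
  qed
  ultimately have "mpoly_const ?N * ?orbit_sum (insert j S) e
    \<in> power_sum_span n (sum e (insert j S))"
    using orbit_sum_insert[OF finite_atLeastAtMost S, of "mpoly_var :: nat \<Rightarrow> (nat, 'a) mpoly" e]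
    by (simp add: mpoly_const.of_nat mpoly.span_diff mpoly.span_sum)
  then have "mpoly_const (1 / ?N) * (mpoly_const ?N * ?orbit_sum (insert j S) e)
    \<in> power_sum_span n (sum e (insert j S))"
    by (rule mpoly.span_scale)
  then show ?case
    using N_nonzero by (simp add: mpoly_const.one flip: mult.assoc mpoly_const.mult)
qed

definition power_sum_combination ::
  "nat \<Rightarrow> nat \<Rightarrow> (nat list \<Rightarrow> 'a) \<Rightarrow> (nat, 'a::comm_ring_1) mpoly" where
  "power_sum_combination n m c = (\<Sum>ks\<in>partitions 1 m. mpoly_const (c ks) * power_sum_product n ks)"

lemma power_sum_combination_add:
  "power_sum_combination n m (\<lambda>ks. c ks + d ks) =
    power_sum_combination n m c + power_sum_combination n m d"
  by (simp add: power_sum_combination_def mpoly_const.add distrib_right sum.distrib)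

lemma power_sum_combination_sum:
  "power_sum_combination n m (\<lambda>ks. \<Sum>t\<in>T. a t * c t ks) =
    (\<Sum>t\<in>T. mpoly_const (a t) * power_sum_combination n m (c t))"
  by (simp add: power_sum_combination_def mpoly_const.sum mpoly_const.mult sum_distrib_left
      sum_distrib_right sum.swap[of _ T] mult.assoc)

lemma power_sum_combination_symmetric: "power_sum_combination n m c \<in> symmetric_forms n m"
  unfolding power_sum_combination_def
proof (rule symmetric_forms_sum)
  fix ks assume "ks \<in> partitions 1 m"
  then show "mpoly_const (c ks) * power_sum_product n ks \<in> symmetric_forms n m"
    using symmetric_forms_mult[OF mpoly_const_symmetric power_sum_product_symmetric, of "c ks" n ks]
    by (simp add: partitions_def)
qed

lemma extend_scalars_power_sum_combination:
  assumes "comm_ring_1_hom \<iota>"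
  shows "extend_scalars \<iota> (power_sum_combination n m c) = power_sum_combination n m (\<lambda>ks. \<iota> (c ks))"
proof -
  interpret \<iota>: comm_ring_1_hom \<iota> by fact
  interpret comm_ring_1_hom "extend_scalars \<iota> :: (nat, _) mpoly \<Rightarrow> _"
    by (rule comm_ring_1_hom_extend_scalars[OF assms])
  show ?thesis
    by (simp add: power_sum_combination_def power_sum_product_def power_sum_def sum mult prod_list_map
        power mpoly_const_def mpoly_var_def extend_scalars_single \<iota>.zero \<iota>.one)
qed

lemma power_sum_span_imp_combination:
  fixes P :: "(nat, 'a::field) mpoly"
  assumes "P \<in> power_sum_span n m"
  shows "\<exists>c. P = power_sum_combination n m c"
  using assms
proof (induction rule: mpoly.span_induct_alt)
  case base
  show ?case
    by (rule exI[of _ "\<lambda>_. 0"]) (simp add: power_sum_combination_def mpoly_const.zero)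
next
  case (step a P Q)
  then obtain ks c where ks: "ks \<in> partitions 1 m" "P = power_sum_product n ks"
    and Q: "Q = power_sum_combination n m c"
    by blast
  have "mpoly_const a * P = power_sum_combination n m (\<lambda>js. if js = ks then a else 0)"
    unfolding power_sum_combination_def sum.remove[OF finite_partitions ks(1)]
    by (simp add: ks(2) mpoly_const.zero)
  then have "mpoly_const a * P + Q =
    power_sum_combination n m (\<lambda>js. (if js = ks then a else 0) + c js)"
    by (simp only: power_sum_combination_add Q)
  then show ?case by (intro exI)
qed

theorem symmetric_form_power_sum_coordinates:
  "\<exists>s :: nat list \<Rightarrow> (nat monomial \<Rightarrow> 'a::field_char_0) \<Rightarrow> 'a. (\<forall>ks. polynomial_fun (s ks)) \<and>
    (\<forall>F\<in>symmetric_forms n m. power_sum_combination n m (\<lambda>ks. s ks (Poly_Mapping.lookup F)) = F)"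
proof -
  let ?orbit_form = "orbit_form n :: nat monomial \<Rightarrow> (nat, 'a) mpoly"
  have "\<exists>c. ?orbit_form t = power_sum_combination n m c" if "t \<in> monomials n m" for t
  proof -
    have support: "Poly_Mapping.keys t \<subseteq> {1..n}" and degree: "monomial_degree t = m"
      using that by (simp_all add: monomials_def)
    have "?orbit_form t \<in> power_sum_span n (monomial_degree t)"
      unfolding monomial_degree_def
      by (rule orbit_sum_in_power_sum_span[OF support]) (metis gr0I in_keys_iff)
    then show ?thesis
      unfolding degree by (rule power_sum_span_imp_combination)
  qed
  then have "\<exists>c. \<forall>t\<in>monomials n m. ?orbit_form t = power_sum_combination n m (c t)"
    by (intro bchoice ballI)
  then obtain c
    where orbit_coordinates: "\<forall>t\<in>monomials n m. ?orbit_form t = power_sum_combination n m (c t)" ..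
  define s where "s ks x = (\<Sum>t\<in>monomials n m. x t / fact n * c t ks)"
    for ks and x :: "nat monomial \<Rightarrow> 'a"
  have "polynomial_fun (s ks)" for ks
    unfolding s_def[abs_def] by (intro polynomial_intros)
  moreover have "power_sum_combination n m (\<lambda>ks. s ks (Poly_Mapping.lookup F)) = F"
    if "F \<in> symmetric_forms n m" for F
  proof -
    have "power_sum_combination n m (\<lambda>ks. s ks (Poly_Mapping.lookup F)) =
      (\<Sum>t\<in>monomials n m. mpoly_const (Poly_Mapping.lookup F t / fact n) * ?orbit_form t)"
      unfolding s_def power_sum_combination_sum using orbit_coordinates
      by (intro sum.cong) auto
    also have "\<dots> = F"
      by (rule symmetric_form_eq_sum_orbit_form[OF that, symmetric])
    finally show ?thesis .
  qed
  ultimately show ?thesis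
    by blast
qed

theorem generic_in_symmetric_formsI:
  fixes f :: "(nat list \<Rightarrow> 'a::field_char_0) \<Rightarrow> 'a"
  assumes "polynomial_fun f" "f z \<noteq> 0" "\<And>c. f c \<noteq> 0 \<Longrightarrow> Q (power_sum_combination n m c)"
  shows "generic_in (symmetric_forms n m) Q"
proof -
  obtain s :: "nat list \<Rightarrow> (nat monomial \<Rightarrow> 'a) \<Rightarrow> 'a" where "\<And>ks. polynomial_fun (s ks)"
    "\<And>F. F \<in> symmetric_forms n m \<Longrightarrow>
      power_sum_combination n m (\<lambda>ks. s ks (Poly_Mapping.lookup F)) = F"
    using symmetric_form_power_sum_coordinates[where 'a = 'a, of n m] by blast
  then show ?thesis
    using assms
    by (intro generic_in_parametrizationI[of "power_sum_combination n m" s _ f z]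
        power_sum_combination_add power_sum_combination_symmetric)
qed

lemma power_sum_combination_4:
  "power_sum_combination n 4 c =
    mpoly_const (c [4]) * power_sum_form n 4 +
    mpoly_const (c [1, 3]) * (power_sum_form n 1 * power_sum_form n 3) +
    mpoly_const (c [2, 2]) * (power_sum_form n 2)\<^sup>2 +
    mpoly_const (c [1, 1, 2]) * ((power_sum_form n 1)\<^sup>2 * power_sum_form n 2) +
    mpoly_const (c [1, 1, 1, 1]) * power_sum_form n 1 ^ 4"
  unfolding power_sum_combination_def partitions_4
  by (simp add: power_sum_product_def eval_nat_numeral ac_simps)

lemma power_sum_combination_5:
  "power_sum_combination n 5 c =
    mpoly_const (c [5]) * power_sum_form n 5 +
    mpoly_const (c [1, 4]) * (power_sum_form n 1 * power_sum_form n 4) +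
    mpoly_const (c [2, 3]) * (power_sum_form n 2 * power_sum_form n 3) +
    mpoly_const (c [1, 1, 3]) * ((power_sum_form n 1)\<^sup>2 * power_sum_form n 3) +
    mpoly_const (c [1, 2, 2]) * (power_sum_form n 1 * (power_sum_form n 2)\<^sup>2) +
    mpoly_const (c [1, 1, 1, 2]) * (power_sum_form n 1 ^ 3 * power_sum_form n 2) +
    mpoly_const (c [1, 1, 1, 1, 1]) * power_sum_form n 1 ^ 5"
  unfolding power_sum_combination_def partitions_5
  by (simp add: power_sum_product_def eval_nat_numeral ac_simps)

section \<open>Sums of powers over two orbits of linear forms\<close>

definition increasing_pairs :: "'i::linorder set \<Rightarrow> ('i \<times> 'i) set" where
  "increasing_pairs I = {(i, j). i \<in> I \<and> j \<in> I \<and> i < j}"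

lemma finite_increasing_pairs: "finite I \<Longrightarrow> finite (increasing_pairs I)"
  by (rule finite_subset[of _ "I \<times> I"]) (auto simp: increasing_pairs_def)

lemma sum_symmetric_eq_sum_increasing_pairs:
  fixes h :: "'i::linorder \<Rightarrow> 'i \<Rightarrow> 'a::comm_semiring_1"
  assumes I: "finite I" and h: "\<And>i j. h i j = h j i"
  shows "(\<Sum>i\<in>I. \<Sum>j\<in>I. h i j) = (\<Sum>i\<in>I. h i i) + 2 * (\<Sum>(i, j)\<in>increasing_pairs I. h i j)"
proof -
  let ?h = "\<lambda>(i, j). h i j"
  let ?P = "increasing_pairs I"
  have "I \<times> I = (\<lambda>i. (i, i)) ` I \<union> (?P \<union> prod.swap ` ?P)"
    by (force simp: increasing_pairs_def)
  then have "(\<Sum>i\<in>I. \<Sum>j\<in>I. h i j) = sum ?h ((\<lambda>i. (i, i)) ` I \<union> (?P \<union> prod.swap ` ?P))"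
    by (simp add: sum.cartesian_product)
  also have "\<dots> = sum ?h ((\<lambda>i. (i, i)) ` I) + (sum ?h ?P + sum ?h (prod.swap ` ?P))"
    using I finite_increasing_pairs[OF I]
    by (subst sum.union_disjoint; (subst sum.union_disjoint)?) (auto simp: increasing_pairs_def)
  also have "sum ?h (prod.swap ` ?P) = sum ?h ?P"
    by (simp add: sum.reindex case_prod_unfold o_def h[of "snd _"])
  also have "sum ?h ((\<lambda>i. (i, i)) ` I) = (\<Sum>i\<in>I. h i i)"
    by (simp add: sum.reindex inj_on_def)
  finally show ?thesis
    by (simp add: mult_2)
qed

lemma card_increasing_pairs: "finite I \<Longrightarrow> card (increasing_pairs I) = card I choose 2"
  using sum_symmetric_eq_sum_increasing_pairs[of I "\<lambda>_ _. 1 :: nat"]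
  by (simp add: choose_two diff_mult_distrib2 case_prod_unfold)

definition vertex_power_sum :: "('i \<Rightarrow> 'a::comm_semiring_1) \<Rightarrow> 'i set \<Rightarrow> 'a \<Rightarrow> nat \<Rightarrow> 'a" where
  "vertex_power_sum x I q m = (\<Sum>i\<in>I. (x i + q) ^ m)"

definition edge_power_sum ::
  "('i::linorder \<Rightarrow> 'a::comm_semiring_1) \<Rightarrow> 'i set \<Rightarrow> 'a \<Rightarrow> nat \<Rightarrow> 'a" where
  "edge_power_sum x I q m = (\<Sum>(i, j)\<in>increasing_pairs I. (x i + x j + q) ^ m)"

lemma power_sum_0: "power_sum x I 0 = of_nat (card I)"
  by (simp add: power_sum_def)

lemma vertex_power_sum_expand:
  "vertex_power_sum x I q m = (\<Sum>k\<le>m. of_nat (m choose k) * power_sum x I k * q ^ (m - k))"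
  unfolding vertex_power_sum_def power_sum_def binomial_ring
  by (subst sum.swap) (simp add: sum_distrib_left sum_distrib_right)

lemma edge_power_sum_expand:
  fixes x :: "'i::linorder \<Rightarrow> 'a::comm_ring_1"
  assumes "finite I"
  shows "2 * edge_power_sum x I q m =
    (\<Sum>k\<le>m. of_nat (m choose k) * power_sum x I k * vertex_power_sum x I q (m - k)) -
    (\<Sum>k\<le>m. of_nat (m choose k) * (2 ^ k * power_sum x I k) * q ^ (m - k))"
proof -
  have "(\<Sum>i\<in>I. \<Sum>j\<in>I. (x i + x j + q) ^ m) = (\<Sum>j\<in>I. vertex_power_sum x I (x j + q) m)"
    unfolding vertex_power_sum_def by (subst sum.swap) (simp add: add.assoc)
  also have "\<dots> = (\<Sum>k\<le>m. of_nat (m choose k) * power_sum x I k * vertex_power_sum x I q (m - k))"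
    by (simp only: vertex_power_sum_expand[of x I "x j + q" for j])
      (subst sum.swap, simp only: vertex_power_sum_def sum_distrib_left)
  finally have "(\<Sum>i\<in>I. (x i + x i + q) ^ m) + 2 * edge_power_sum x I q m =
    (\<Sum>k\<le>m. of_nat (m choose k) * power_sum x I k * vertex_power_sum x I q (m - k))"
    unfolding edge_power_sum_def
    by (subst (asm) sum_symmetric_eq_sum_increasing_pairs[OF assms])
      (simp_all add: add.commute add.left_commute)
  moreover have "(\<Sum>i\<in>I. (x i + x i + q) ^ m) = vertex_power_sum (\<lambda>i. 2 * x i) I q m"
    by (simp add: vertex_power_sum_def flip: mult_2)
  moreover have "power_sum (\<lambda>i. 2 * x i) I k = 2 ^ k * power_sum x I k" for k
    by (simp add: power_sum_def power_mult_distrib sum_distrib_left)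
  ultimately show ?thesis
    unfolding eq_diff_eq by (simp only: vertex_power_sum_expand[of "\<lambda>i. 2 * x i"] add.commute)
qed

lemma two_times_of_nat_choose_two:
  "2 * of_nat (n choose 2) = (of_nat n * (of_nat n - 1) :: 'a::comm_ring_1)"
proof -
  have "2 * (n choose 2) + n = n * n"
    by (cases n) (simp_all add: choose_two)
  then have "(of_nat (2 * (n choose 2) + n) :: 'a) = of_nat (n * n)"
    by (rule arg_cong)
  then show ?thesis
    by (simp add: algebra_simps)
qed

lemma vertex_power_sum_4:
  "vertex_power_sum x I q 4 = power_sum x I 4 + 4 * power_sum x I 3 * q +
    6 * power_sum x I 2 * q\<^sup>2 + 4 * power_sum x I 1 * q ^ 3 + of_nat (card I) * q ^ 4"
  by (simp add: vertex_power_sum_expand power_sum_0 eval_nat_numeral algebra_simps)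

lemma edge_power_sum_4:
  fixes x :: "'i::linorder \<Rightarrow> 'a::comm_ring_1"
  assumes "finite I"
  defines "N \<equiv> of_nat (card I)" and "p \<equiv> power_sum x I"
  shows "2 * edge_power_sum x I q 4 = (2 * N - 16) * p 4 + 8 * p 1 * p 3 + 6 * (p 2)\<^sup>2 +
    ((8 * N - 32) * p 3 + 24 * p 1 * p 2) * q + ((12 * N - 24) * p 2 + 12 * (p 1)\<^sup>2) * q\<^sup>2 +
    (8 * N - 8) * p 1 * q ^ 3 + 2 * of_nat (card I choose 2) * q ^ 4"
  unfolding edge_power_sum_expand[OF assms(1)] two_times_of_nat_choose_two N_def p_def
  by (simp add: vertex_power_sum_expand power_sum_0 eval_nat_numeral algebra_simps)

lemma vertex_power_sum_5:
  "vertex_power_sum x I q 5 = power_sum x I 5 + 5 * power_sum x I 4 * q + 10 * power_sum x I 3 * q\<^sup>2 +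
    10 * power_sum x I 2 * q ^ 3 + 5 * power_sum x I 1 * q ^ 4 + of_nat (card I) * q ^ 5"
  by (simp add: vertex_power_sum_expand power_sum_0 eval_nat_numeral algebra_simps)

lemma edge_power_sum_5:
  fixes x :: "'i::linorder \<Rightarrow> 'a::comm_ring_1"
  assumes "finite I"
  defines "N \<equiv> of_nat (card I)" and "p \<equiv> power_sum x I"
  shows "2 * edge_power_sum x I q 5 = (2 * N - 32) * p 5 + 10 * p 1 * p 4 + 20 * p 2 * p 3 +
    ((10 * N - 80) * p 4 + 40 * p 1 * p 3 + 30 * (p 2)\<^sup>2) * q +
    ((20 * N - 80) * p 3 + 60 * p 1 * p 2) * q\<^sup>2 +
    ((20 * N - 40) * p 2 + 20 * (p 1)\<^sup>2) * q ^ 3 +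
    (10 * N - 10) * p 1 * q ^ 4 + 2 * of_nat (card I choose 2) * q ^ 5"
  unfolding edge_power_sum_expand[OF assms(1)] two_times_of_nat_choose_two N_def p_def
  by (simp add: vertex_power_sum_expand power_sum_0 eval_nat_numeral algebra_simps)

lemma quartic_eq_sum_orbit_powers:
  fixes x :: "'i::linorder \<Rightarrow> 'a::idom"
  assumes I: "finite I" and two: "(2::'a) \<noteq> 0"
  defines "N \<equiv> of_nat (card I)" and "p \<equiv> power_sum x I"
  assumes A: "A = w + (N - 8) * C"
    and B: "B = w * s + C + (N - 4) * C * t"
    and D: "D = w * s\<^sup>2 + 2 * C * t + (N - 2) * C * t\<^sup>2"
    and E: "E = w * (4 * s ^ 3 + N * s ^ 4) +
      C * (6 * t\<^sup>2 + 4 * (N - 1) * t ^ 3 + of_nat (card I choose 2) * t ^ 4) + u"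
  shows "A * p 4 + 4 * B * (p 1 * p 3) + 3 * C * (p 2)\<^sup>2 + 6 * D * ((p 1)\<^sup>2 * p 2) + E * p 1 ^ 4 =
    w * vertex_power_sum x I (s * p 1) 4 + C * edge_power_sum x I (t * p 1) 4 + u * p 1 ^ 4"
    (is "?lhs = ?rhs")
proof -
  have "2 * ?lhs = 2 * ?rhs"
    using edge_power_sum_4[OF I, of x "t * p 1"] unfolding vertex_power_sum_4 A B D E N_def p_def
    by algebra
  then show ?thesis
    by (simp only: mult_left_cancel[OF two])
qed

lemma quintic_eq_sum_orbit_powers:
  fixes x :: "'i::linorder \<Rightarrow> 'a::idom"
  assumes I: "finite I" and two: "(2::'a) \<noteq> 0"
  defines "N \<equiv> of_nat (card I)" and "p \<equiv> power_sum x I"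
  assumes A: "A = w + w' + (N - 16) * Q"
    and B: "B = w * s + w' * s' + Q + (N - 8) * Q * t"
    and G: "G = w * s\<^sup>2 + w' * s'\<^sup>2 + 2 * Q * t + (N - 4) * Q * t\<^sup>2"
    and R: "R = Q * t"
    and H: "H = w * s ^ 3 + w' * s' ^ 3 + 3 * Q * t\<^sup>2 + (N - 2) * Q * t ^ 3"
    and E: "E = w * (5 * s ^ 4 + N * s ^ 5) + w' * (5 * s' ^ 4 + N * s' ^ 5) +
      Q * (10 * t ^ 3 + 5 * (N - 1) * t ^ 4 + of_nat (card I choose 2) * t ^ 5) + u"
  shows "A * p 5 + 5 * B * (p 1 * p 4) + 10 * Q * (p 2 * p 3) + 10 * G * ((p 1)\<^sup>2 * p 3) +
      15 * R * (p 1 * (p 2)\<^sup>2) + 10 * H * (p 1 ^ 3 * p 2) + E * p 1 ^ 5 =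
    w * vertex_power_sum x I (s * p 1) 5 + w' * vertex_power_sum x I (s' * p 1) 5 +
      Q * edge_power_sum x I (t * p 1) 5 + u * p 1 ^ 5"
    (is "?lhs = ?rhs")
proof -
  have "2 * ?lhs = 2 * ?rhs"
    using edge_power_sum_5[OF I, of x "t * p 1"] unfolding vertex_power_sum_5 A B G R H E N_def p_def
    by algebra
  then show ?thesis
    by (simp only: mult_left_cancel[OF two])
qed

section \<open>Waring rank\<close>

lemma waring_rank_sum_powers_le:
  assumes "finite J" "\<And>j. j \<in> J \<Longrightarrow> L j \<in> forms n 1"
  shows "waring_rank n m (\<Sum>j\<in>J. L j ^ m) \<le> enat (card J)"
proof -
  obtain \<phi> where \<phi>: "bij_betw \<phi> {..<card J} J"
    using ex_bij_betw_nat_finite[OF assms(1)] unfolding lessThan_atLeast0 by blast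
  have "(\<Sum>j\<in>J. L j ^ m) = (\<Sum>i<card J. L (\<phi> i) ^ m)"
    by (rule sum.reindex_bij_betw[OF \<phi>, symmetric])
  moreover have "\<forall>i<card J. L (\<phi> i) \<in> forms n 1"
    using \<phi> assms(2) by (metis bij_betw_apply lessThan_iff)
  ultimately show ?thesis
    unfolding waring_rank_def by (intro INF_lower) (auto intro!: exI[of _ "\<lambda>i. L (\<phi> i)"])
qed

lemma waring_rank_eq_enatE:
  assumes "waring_rank n m F = enat r"
  obtains L where "\<And>i. i < r \<Longrightarrow> L i \<in> forms n 1" "F = (\<Sum>i<r. L i ^ m)"
proof -
  let ?R = "{r. \<exists>L. (\<forall>i<r. L i \<in> forms n 1) \<and> F = (\<Sum>i<r. L i ^ m)}"
  have "waring_rank n m F = \<infinity>" if "enat ` ?R = {}"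
    unfolding waring_rank_def that by (simp add: top_enat_def)
  then have "enat ` ?R \<noteq> {}"
    using assms by auto
  then have "waring_rank n m F \<in> enat ` ?R"
    unfolding waring_rank_def ex_in_conv[symmetric] by (elim exE) (rule wellorder_InfI)
  then have "r \<in> ?R"
    unfolding assms by (elim imageE) (simp only: enat.inject)
  then show thesis
    using that by blast
qed

lemma waring_rank_add_le: "waring_rank n m (F + G) \<le> waring_rank n m F + waring_rank n m G"
proof (cases "waring_rank n m F"; cases "waring_rank n m G")
  fix r s assume r: "waring_rank n m F = enat r" and s: "waring_rank n m G = enat s"
  obtain K where K: "\<And>i. i < r \<Longrightarrow> K i \<in> forms n 1" "F = (\<Sum>i<r. K i ^ m)"
    using waring_rank_eq_enatE[OF r] by blast
  obtain L where L: "\<And>i. i < s \<Longrightarrow> L i \<in> forms n 1" "G = (\<Sum>i<s. L i ^ m)"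
    using waring_rank_eq_enatE[OF s] by blast
  have "F + G = (\<Sum>j\<in>{..<r} <+> {..<s}. case_sum K L j ^ m)"
    by (simp add: sum.Plus K(2) L(2))
  then have "waring_rank n m (F + G) \<le> enat (card ({..<r} <+> {..<s}))"
    using K(1) L(1) by (auto intro!: waring_rank_sum_powers_le)
  then show ?thesis
    by (simp add: r s card_Plus)
qed simp_all

lemma waring_rank_scaled_sum_powers_le:
  fixes L :: "'j \<Rightarrow> (nat, 'a::alg_closed_field) mpoly"
  assumes "0 < m" "finite J" "\<And>j. j \<in> J \<Longrightarrow> L j \<in> forms n 1"
  shows "waring_rank n m (mpoly_const c * (\<Sum>j\<in>J. L j ^ m)) \<le> enat (card J)"
proof -
  obtain a where "a ^ m = c"
    using nth_root_exists[OF assms(1)] by blast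
  then have "mpoly_const c * (\<Sum>j\<in>J. L j ^ m) = (\<Sum>j\<in>J. (mpoly_const a * L j) ^ m)"
    by (simp add: sum_distrib_left power_mult_distrib flip: mpoly_const.power)
  moreover have "mpoly_const a * L j \<in> forms n 1" if "j \<in> J" for j
    using forms_mult[OF mpoly_const_in_forms assms(3)[OF that]] by simp
  ultimately show ?thesis
    using waring_rank_sum_powers_le[OF assms(2), of "\<lambda>j. mpoly_const a * L j" n m] by simp
qed

lemma mpoly_var_in_forms: "i \<in> {1..n} \<Longrightarrow> (mpoly_var i :: (nat, 'a::comm_ring_1) mpoly) \<in> forms n 1"
  using mpoly_var_power_in_forms[of i n 1] by simp

lemma power_sum_1_in_forms: "power_sum_form n 1 \<in> forms n 1"
  using power_sum_symmetric unfolding symmetric_forms_def by blast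

lemma scaled_power_sum_1_in_forms: "mpoly_const s * power_sum_form n 1 \<in> forms n 1"
  by (rule forms_mult[OF mpoly_const_in_forms power_sum_1_in_forms, unfolded add_0])

abbreviation vertex_form :: "nat \<Rightarrow> nat \<Rightarrow> 'a \<Rightarrow> 'a \<Rightarrow> (nat, 'a::comm_ring_1) mpoly" where
  "vertex_form n m c s \<equiv>
    mpoly_const c * vertex_power_sum mpoly_var {1..n} (mpoly_const s * power_sum_form n 1) m"

abbreviation edge_form :: "nat \<Rightarrow> nat \<Rightarrow> 'a \<Rightarrow> 'a \<Rightarrow> (nat, 'a::comm_ring_1) mpoly" where
  "edge_form n m c t \<equiv>
    mpoly_const c * edge_power_sum mpoly_var {1..n} (mpoly_const t * power_sum_form n 1) m"

abbreviation center_form :: "nat \<Rightarrow> nat \<Rightarrow> 'a \<Rightarrow> (nat, 'a::comm_ring_1) mpoly" where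
  "center_form n m c \<equiv> mpoly_const c * power_sum_form n 1 ^ m"

context
  fixes n m :: nat
  assumes m: "0 < m"
begin

lemma waring_rank_vertex_form_le:
  fixes c s :: "'a::alg_closed_field"
  shows "waring_rank n m (vertex_form n m c s) \<le> enat n"
proof -
  have "waring_rank n m (vertex_form n m c s) \<le> enat (card {1..n})"
    unfolding vertex_power_sum_def
    by (intro waring_rank_scaled_sum_powers_le m finite_atLeastAtMost
        forms_add mpoly_var_in_forms scaled_power_sum_1_in_forms)
  then show ?thesis by simp
qed

lemma waring_rank_edge_form_le:
  fixes c t :: "'a::alg_closed_field"
  shows "waring_rank n m (edge_form n m c t) \<le> enat (n choose 2)"
proof -
  have "waring_rank n m (edge_form n m c t) \<le> enat (card (increasing_pairs {1..n}))"
    unfolding edge_power_sum_def case_prod_unfold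
    by (intro waring_rank_scaled_sum_powers_le m finite_increasing_pairs finite_atLeastAtMost
        forms_add mpoly_var_in_forms scaled_power_sum_1_in_forms) (auto simp: increasing_pairs_def)
  then show ?thesis
    by (simp add: card_increasing_pairs)
qed

lemma waring_rank_center_form_le:
  fixes c :: "'a::alg_closed_field"
  shows "waring_rank n m (center_form n m c) \<le> 1"
proof -
  have "waring_rank n m (mpoly_const c * (\<Sum>_\<in>{()}. power_sum_form n 1 ^ m)) \<le> enat (card {()})"
    by (intro waring_rank_scaled_sum_powers_le m power_sum_1_in_forms) simp
  then show ?thesis by (simp add: one_enat_def)
qed

end

section \<open>Solving for the linear forms\<close>

lemma quadratic_root_exists:
  fixes a b c :: "'a::alg_closed_field"
  assumes "a \<noteq> 0"
  shows "\<exists>t. a * t\<^sup>2 + b * t + c = 0"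
proof -
  obtain t where "poly [:c, b, a:] t = 0"
    using alg_closed_imp_poly_has_root[of "[:c, b, a:]"] assms by auto
  then show ?thesis
    by (intro exI[of _ t]) (simp add: algebra_simps power2_eq_square)
qed

text \<open>
  The factors are \<open>C\<close>, the weight \<open>w\<close> of the vertex orbit, and the leading coefficient of the quadratic
  equation for \<open>t\<close> that remains after elimination of \<open>s\<close>.
\<close>

definition quartic_degeneracy :: "'a::comm_ring_1 \<Rightarrow> 'a \<Rightarrow> 'a \<Rightarrow> 'a" where
  "quartic_degeneracy N A C =
    C * (A - (N - 8) * C) * ((N - 4)\<^sup>2 * C + (N - 2) * (A - (N - 8) * C))"

lemma quartic_degeneracy_witness:
  "quartic_degeneracy (of_nat n) (of_nat n - 7) 1 \<noteq> (0 :: 'a::{comm_ring_1, ring_char_0})"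
proof -
  have "(int n - 4)\<^sup>2 + (int n - 2) \<noteq> 0"
  proof
    assume "(int n - 4)\<^sup>2 + (int n - 2) = 0"
    then have "(2 * int n - 7)\<^sup>2 + 7 = 0" by algebra
    then show False using zero_le_power2[of "2 * int n - 7"] by linarith
  qed
  then have "of_int ((int n - 4)\<^sup>2 + (int n - 2)) \<noteq> (0 :: 'a)"
    unfolding of_int_eq_0_iff .
  then show ?thesis
    by (simp add: quartic_degeneracy_def)
qed

lemma quartic_parameters_exist:
  fixes A B C D N :: "'a::alg_closed_field"
  assumes nondegenerate: "quartic_degeneracy N A C \<noteq> 0"
  shows "\<exists>w s t. A = w + (N - 8) * C \<and>
    B = w * s + C + (N - 4) * C * t \<and>
    D = w * s\<^sup>2 + 2 * C * t + (N - 2) * C * t\<^sup>2"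
proof -
  define w where "w = A - (N - 8) * C"
  have w: "w \<noteq> 0" and "C * ((N - 4)\<^sup>2 * C + (N - 2) * w) \<noteq> 0"
    using nondegenerate by (simp_all add: quartic_degeneracy_def w_def)
  then obtain t where t: "C * ((N - 4)\<^sup>2 * C + (N - 2) * w) * t\<^sup>2 +
      (2 * C * w - 2 * (B - C) * (N - 4) * C) * t + ((B - C)\<^sup>2 - w * D) = 0"
    using quadratic_root_exists by blast
  define s where "s = (B - C - (N - 4) * C * t) / w"
  have s: "w * s = B - C - (N - 4) * C * t"
    using w by (simp add: s_def)
  have "w * D = w * (w * s\<^sup>2 + 2 * C * t + (N - 2) * C * t\<^sup>2)"
    using s t by algebra
  then have "D = w * s\<^sup>2 + 2 * C * t + (N - 2) * C * t\<^sup>2"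
    by (simp only: mult_left_cancel[OF w])
  moreover have "A = w + (N - 8) * C"
    by (simp add: w_def)
  moreover have "B = w * s + C + (N - 4) * C * t"
    by (simp add: s)
  ultimately show ?thesis
    by blast
qed

lemma two_weights_exist:
  fixes s s' :: "'a::field"
  assumes "s \<noteq> s'" "\<gamma> = (s + s') * \<beta> - s * s' * \<alpha>" "\<delta> = (s + s') * \<gamma> - s * s' * \<beta>"
  shows "\<exists>w w'. w + w' = \<alpha> \<and> w * s + w' * s' = \<beta> \<and>
    w * s\<^sup>2 + w' * s'\<^sup>2 = \<gamma> \<and> w * s ^ 3 + w' * s' ^ 3 = \<delta>"
proof -
  define w where "w = (\<beta> - s' * \<alpha>) / (s - s')"
  have w: "w * (s - s') = \<beta> - s' * \<alpha>"
    using assms(1) by (simp add: w_def)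
  have "w * s + (\<alpha> - w) * s' = \<beta>"
    "w * s\<^sup>2 + (\<alpha> - w) * s'\<^sup>2 = \<gamma>" "w * s ^ 3 + (\<alpha> - w) * s' ^ 3 = \<delta>"
    using w assms(2,3) by algebra+
  then show ?thesis
    by (intro exI[of _ w] exI[of _ "\<alpha> - w"]) simp
qed

definition two_node_degeneracy :: "'a::comm_ring_1 \<Rightarrow> 'a \<Rightarrow> 'a \<Rightarrow> 'a \<Rightarrow> 'a" where
  "two_node_degeneracy \<alpha> \<beta> \<gamma> \<delta> =
    (\<alpha> * \<gamma> - \<beta>\<^sup>2) * ((\<alpha> * \<delta> - \<beta> * \<gamma>)\<^sup>2 - 4 * (\<alpha> * \<gamma> - \<beta>\<^sup>2) * (\<beta> * \<delta> - \<gamma>\<^sup>2))"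

text \<open>Sylvester's method: the nodes are the roots of the quadratic recurrence satisfied by the moments.\<close>

lemma two_node_moments_exist:
  fixes \<alpha> \<beta> \<gamma> \<delta> :: "'a::alg_closed_field"
  assumes nondegenerate: "two_node_degeneracy \<alpha> \<beta> \<gamma> \<delta> \<noteq> 0"
  shows "\<exists>w s w' s'. w + w' = \<alpha> \<and> w * s + w' * s' = \<beta> \<and>
    w * s\<^sup>2 + w' * s'\<^sup>2 = \<gamma> \<and> w * s ^ 3 + w' * s' ^ 3 = \<delta>"
proof -
  define \<mu> where "\<mu> = \<alpha> * \<gamma> - \<beta>\<^sup>2"
  define \<sigma> where "\<sigma> = (\<alpha> * \<delta> - \<beta> * \<gamma>) / \<mu>"
  define \<rho> where "\<rho> = (\<beta> * \<delta> - \<gamma>\<^sup>2) / \<mu>"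
  have \<mu>: "\<mu> \<noteq> 0"
    and discriminant: "(\<alpha> * \<delta> - \<beta> * \<gamma>)\<^sup>2 - 4 * \<mu> * (\<beta> * \<delta> - \<gamma>\<^sup>2) \<noteq> 0"
    using nondegenerate by (simp_all add: two_node_degeneracy_def \<mu>_def)
  have \<sigma>: "\<mu> * \<sigma> = \<alpha> * \<delta> - \<beta> * \<gamma>" and \<rho>: "\<mu> * \<rho> = \<beta> * \<delta> - \<gamma>\<^sup>2"
    using \<mu> by (simp_all add: \<sigma>_def \<rho>_def)
  have "\<mu> * \<gamma> = \<mu> * (\<sigma> * \<beta> - \<rho> * \<alpha>)" "\<mu> * \<delta> = \<mu> * (\<sigma> * \<gamma> - \<rho> * \<beta>)"
    using \<sigma> \<rho> unfolding \<mu>_def by algebra+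
  then have recurrence: "\<gamma> = \<sigma> * \<beta> - \<rho> * \<alpha>" "\<delta> = \<sigma> * \<gamma> - \<rho> * \<beta>"
    by (simp_all only: mult_left_cancel[OF \<mu>])
  obtain s where "1 * s\<^sup>2 + (- \<sigma>) * s + \<rho> = 0"
    using quadratic_root_exists[of 1 "- \<sigma>" \<rho>] by auto
  then have vieta: "s + (\<sigma> - s) = \<sigma>" "s * (\<sigma> - s) = \<rho>"
    by (simp_all add: algebra_simps power2_eq_square)
  have "\<mu>\<^sup>2 * (s - (\<sigma> - s))\<^sup>2 = (\<mu> * \<sigma>)\<^sup>2 - 4 * \<mu> * (\<mu> * \<rho>)"
    unfolding vieta(2)[symmetric] by algebra
  then have "s \<noteq> \<sigma> - s"
    using discriminant unfolding \<sigma> \<rho> by auto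
  from two_weights_exist[OF this, unfolded vieta, OF recurrence] show ?thesis
    by blast
qed

text \<open>
  The moments of the two vertex orbits are \<open>A - (N - 16) Q\<close>, \<open>B - Q - (N - 8) Q t\<close>,
  \<open>G - 2 Q t - (N - 4) Q t\<^sup>2\<close> and \<open>H - 3 Q t\<^sup>2 - (N - 2) Q t\<^sup>3\<close> with \<open>t = R / Q\<close>. Scaling both nodes
  by \<open>Q\<close> clears the denominators.
\<close>

definition quintic_degeneracy ::
  "'a::comm_ring_1 \<Rightarrow> 'a \<Rightarrow> 'a \<Rightarrow> 'a \<Rightarrow> 'a \<Rightarrow> 'a \<Rightarrow> 'a \<Rightarrow> 'a" where
  "quintic_degeneracy N A B Q G R H = Q * two_node_degeneracy
    (A - (N - 16) * Q)
    (Q * (B - Q - (N - 8) * R))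
    (Q * (Q * G - 2 * Q * R - (N - 4) * R\<^sup>2))
    (Q * (Q\<^sup>2 * H - 3 * Q * R\<^sup>2 - (N - 2) * R ^ 3))"

lemma quintic_parameters_exist:
  fixes A B Q G R H N :: "'a::alg_closed_field"
  assumes nondegenerate: "quintic_degeneracy N A B Q G R H \<noteq> 0"
  shows "\<exists>w s w' s' t. A = w + w' + (N - 16) * Q \<and>
    B = w * s + w' * s' + Q + (N - 8) * Q * t \<and>
    G = w * s\<^sup>2 + w' * s'\<^sup>2 + 2 * Q * t + (N - 4) * Q * t\<^sup>2 \<and>
    R = Q * t \<and>
    H = w * s ^ 3 + w' * s' ^ 3 + 3 * Q * t\<^sup>2 + (N - 2) * Q * t ^ 3"
proof -
  have Q: "Q \<noteq> 0"
    using nondegenerate by (simp add: quintic_degeneracy_def)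
  obtain w v w' v' where moments: "w + w' = A - (N - 16) * Q"
    "w * v + w' * v' = Q * (B - Q - (N - 8) * R)"
    "w * v\<^sup>2 + w' * v'\<^sup>2 = Q * (Q * G - 2 * Q * R - (N - 4) * R\<^sup>2)"
    "w * v ^ 3 + w' * v' ^ 3 = Q * (Q\<^sup>2 * H - 3 * Q * R\<^sup>2 - (N - 2) * R ^ 3)"
    using two_node_moments_exist nondegenerate unfolding quintic_degeneracy_def mult_eq_0_iff by metis
  define s s' t where "s = v / Q" and "s' = v' / Q" and "t = R / Q"
  then have v: "v = Q * s" "v' = Q * s'" and R: "R = Q * t"
    using Q by simp_all
  have "A = w + w' + (N - 16) * Q"
    by (simp add: moments(1))
  moreover have "Q * B = Q * (w * s + w' * s' + Q + (N - 8) * Q * t)"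
    using moments(2) unfolding v R by algebra
  then have "B = w * s + w' * s' + Q + (N - 8) * Q * t"
    by (simp only: mult_left_cancel[OF Q])
  moreover have "Q\<^sup>2 * G = Q\<^sup>2 * (w * s\<^sup>2 + w' * s'\<^sup>2 + 2 * Q * t + (N - 4) * Q * t\<^sup>2)"
    using moments(3) unfolding v R by algebra
  then have "G = w * s\<^sup>2 + w' * s'\<^sup>2 + 2 * Q * t + (N - 4) * Q * t\<^sup>2"
    by (simp only: mult_left_cancel[OF power_not_zero[OF Q]])
  moreover have "Q ^ 3 * H = Q ^ 3 * (w * s ^ 3 + w' * s' ^ 3 + 3 * Q * t\<^sup>2 + (N - 2) * Q * t ^ 3)"
    using moments(4) unfolding v R by algebra
  then have "H = w * s ^ 3 + w' * s' ^ 3 + 3 * Q * t\<^sup>2 + (N - 2) * Q * t ^ 3"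
    by (simp only: mult_left_cancel[OF power_not_zero[OF Q]])
  ultimately show ?thesis
    using R by blast
qed

context comm_ring_1_hom
begin

lemmas hom_simps = add diff mult power numeral of_nat

lemma quartic_degeneracy:
  "h (quartic_degeneracy N A C) = quartic_degeneracy (h N) (h A) (h C)"
  by (simp add: quartic_degeneracy_def hom_simps)

lemma quintic_degeneracy:
  "h (quintic_degeneracy N A B Q G R H) = quintic_degeneracy (h N) (h A) (h B) (h Q) (h G) (h R) (h H)"
  by (simp add: quintic_degeneracy_def two_node_degeneracy_def hom_simps)

end

section \<open>Generic symmetric quartics and quintics\<close>

lemma two_neq_0_mpoly: "(2::'a::field) \<noteq> 0 \<Longrightarrow> (2 :: ('v, 'a) mpoly) \<noteq> 0"
  by (simp add: mpoly_const_eq_0_iff flip: mpoly_const.numeral)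

lemma power_sum_combination_4_eq_orbit_forms:
  fixes c :: "nat list \<Rightarrow> 'a::alg_closed_field"
  assumes two: "(2::'a) \<noteq> 0"
    and coordinates: "c [4] = A" "c [1, 3] = 4 * B" "c [2, 2] = 3 * C" "c [1, 1, 2] = 6 * D"
    and nondegenerate: "quartic_degeneracy (of_nat n) A C \<noteq> 0"
  shows "\<exists>w s t u. power_sum_combination n 4 c =
    vertex_form n 4 w s + edge_form n 4 C t + center_form n 4 u"
proof -
  obtain w s t where parameters: "A = w + (of_nat n - 8) * C"
    "B = w * s + C + (of_nat n - 4) * C * t"
    "D = w * s\<^sup>2 + 2 * C * t + (of_nat n - 2) * C * t\<^sup>2"
    using quartic_parameters_exist[OF nondegenerate] by blast
  define u where "u = c [1, 1, 1, 1] - (w * (4 * s ^ 3 + of_nat n * s ^ 4) +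
    C * (6 * t\<^sup>2 + 4 * (of_nat n - 1) * t ^ 3 + of_nat (n choose 2) * t ^ 4))"
  have "power_sum_combination n 4 c = vertex_form n 4 w s + edge_form n 4 C t + center_form n 4 u"
    unfolding power_sum_combination_4 coordinates mpoly_const.mult mpoly_const.numeral
    by (rule quartic_eq_sum_orbit_powers[OF _ two_neq_0_mpoly[OF two]])
      (simp_all add: parameters u_def flip: mpoly_const.hom_simps mpoly_const.one)
  then show ?thesis
    by blast
qed

lemma power_sum_combination_5_eq_orbit_forms:
  fixes c :: "nat list \<Rightarrow> 'a::alg_closed_field"
  assumes two: "(2::'a) \<noteq> 0"
    and coordinates: "c [5] = A" "c [1, 4] = 5 * B" "c [2, 3] = 10 * Q" "c [1, 1, 3] = 10 * G"
      "c [1, 2, 2] = 15 * R" "c [1, 1, 1, 2] = 10 * H"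
    and nondegenerate: "quintic_degeneracy (of_nat n) A B Q G R H \<noteq> 0"
  shows "\<exists>w s w' s' t u. power_sum_combination n 5 c =
    vertex_form n 5 w s + vertex_form n 5 w' s' + edge_form n 5 Q t + center_form n 5 u"
proof -
  obtain w s w' s' t where parameters: "A = w + w' + (of_nat n - 16) * Q"
    "B = w * s + w' * s' + Q + (of_nat n - 8) * Q * t"
    "G = w * s\<^sup>2 + w' * s'\<^sup>2 + 2 * Q * t + (of_nat n - 4) * Q * t\<^sup>2"
    "R = Q * t"
    "H = w * s ^ 3 + w' * s' ^ 3 + 3 * Q * t\<^sup>2 + (of_nat n - 2) * Q * t ^ 3"
    using quintic_parameters_exist[OF nondegenerate] by blast
  define u where "u = c [1, 1, 1, 1, 1] -
    (w * (5 * s ^ 4 + of_nat n * s ^ 5) + w' * (5 * s' ^ 4 + of_nat n * s' ^ 5) +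
      Q * (10 * t ^ 3 + 5 * (of_nat n - 1) * t ^ 4 + of_nat (n choose 2) * t ^ 5))"
  have "power_sum_combination n 5 c =
    vertex_form n 5 w s + vertex_form n 5 w' s' + edge_form n 5 Q t + center_form n 5 u"
    unfolding power_sum_combination_5 coordinates mpoly_const.mult mpoly_const.numeral
    by (rule quintic_eq_sum_orbit_powers[OF _ two_neq_0_mpoly[OF two]])
      (simp_all add: parameters u_def flip: mpoly_const.hom_simps mpoly_const.one)
  then show ?thesis
    by blast
qed

lemmas waring_rank_orbit_forms_le =
  waring_rank_vertex_form_le waring_rank_edge_form_le waring_rank_center_form_le

lemma waring_rank_quartic_orbit_forms_le:
  fixes w s c t u :: "'a::alg_closed_field"
  shows "waring_rank n 4 (vertex_form n 4 w s + edge_form n 4 c t + center_form n 4 u)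
    \<le> enat (((n + 1) choose 2) + 1)"
proof -
  have "waring_rank n 4 (vertex_form n 4 w s + edge_form n 4 c t + center_form n 4 u)
    \<le> enat n + enat (n choose 2) + 1"
    by (intro order_trans[OF waring_rank_add_le] add_mono waring_rank_orbit_forms_le) simp_all
  then show ?thesis
    by (simp add: one_enat_def numeral_2_eq_2 add.assoc)
qed

lemma waring_rank_quintic_orbit_forms_le:
  fixes w s w' s' c t u :: "'a::alg_closed_field"
  shows "waring_rank n 5
      (vertex_form n 5 w s + vertex_form n 5 w' s' + edge_form n 5 c t + center_form n 5 u)
    \<le> enat ((n + 2) choose 2)"
proof -
  have "waring_rank n 5
      (vertex_form n 5 w s + vertex_form n 5 w' s' + edge_form n 5 c t + center_form n 5 u)
    \<le> enat n + enat n + enat (n choose 2) + 1"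
    by (intro order_trans[OF waring_rank_add_le] add_mono waring_rank_orbit_forms_le) simp_all
  then show ?thesis
    by (simp add: one_enat_def numeral_2_eq_2 add.assoc)
qed

lemma generic_symmetric_quartic:
  fixes \<iota> :: "'k::field_char_0 \<Rightarrow> 'K::alg_closed_field"
  assumes "field_embedding \<iota>"
  shows "generic_in (symmetric_forms n 4 :: (nat, 'k) mpoly set)
    (\<lambda>F. waring_rank n 4 (extend_scalars \<iota> F) \<le> enat (((n + 1) choose 2) + 1))"
proof -
  note hom = comm_ring_1_hom_field_embedding[OF assms]
  interpret \<iota>: comm_ring_1_hom \<iota> by (rule hom)
  note \<iota>_eq_0_iff = comm_ring_1_hom_eq_0_iff[OF hom]
  define f :: "(nat list \<Rightarrow> 'k) \<Rightarrow> 'k" where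
    "f c = quartic_degeneracy (of_nat n) (c [4]) (c [2, 2] / 3)" for c
  define z :: "nat list \<Rightarrow> 'k" where "z = (\<lambda>_. 0)([4] := of_nat n - 7, [2, 2] := 3)"
  show ?thesis
  proof (rule generic_in_symmetric_formsI[of f z])
    show "polynomial_fun f"
      unfolding f_def quartic_degeneracy_def by (intro polynomial_intros)
    show "f z \<noteq> 0"
      using quartic_degeneracy_witness[of n, where 'a = 'k] by (simp add: f_def z_def)
  next
    fix c assume "f c \<noteq> 0"
    then have "quartic_degeneracy (of_nat n) (\<iota> (c [4])) (\<iota> (c [2, 2] / 3)) \<noteq> 0"
      unfolding f_def by (simp add: \<iota>_eq_0_iff flip: \<iota>.quartic_degeneracy \<iota>.of_nat)
    moreover have "(2 :: 'K) \<noteq> 0"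
      using \<iota>_eq_0_iff[of 2] by (simp add: \<iota>.numeral)
    ultimately have "\<exists>w s t u. power_sum_combination n 4 (\<lambda>ks. \<iota> (c ks)) =
      vertex_form n 4 w s + edge_form n 4 (\<iota> (c [2, 2] / 3)) t + center_form n 4 u"
      by (intro power_sum_combination_4_eq_orbit_forms[where B = "\<iota> (c [1, 3] / 4)"
            and D = "\<iota> (c [1, 1, 2] / 6)"])
        (simp_all flip: \<iota>.mult \<iota>.numeral)
    then show "waring_rank n 4 (extend_scalars \<iota> (power_sum_combination n 4 c))
      \<le> enat (((n + 1) choose 2) + 1)"
      using waring_rank_quartic_orbit_forms_le
      by (auto simp only: extend_scalars_power_sum_combination[OF hom])
  qed
qed

lemma generic_symmetric_quintic:
  fixes \<iota> :: "'k::field_char_0 \<Rightarrow> 'K::alg_closed_field"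
  assumes "field_embedding \<iota>"
  shows "generic_in (symmetric_forms n 5 :: (nat, 'k) mpoly set)
    (\<lambda>F. waring_rank n 5 (extend_scalars \<iota> F) \<le> enat ((n + 2) choose 2))"
proof -
  note hom = comm_ring_1_hom_field_embedding[OF assms]
  interpret \<iota>: comm_ring_1_hom \<iota> by (rule hom)
  note \<iota>_eq_0_iff = comm_ring_1_hom_eq_0_iff[OF hom]
  define f :: "(nat list \<Rightarrow> 'k) \<Rightarrow> 'k" where
    "f c = quintic_degeneracy (of_nat n) (c [5]) (c [1, 4] / 5) (c [2, 3] / 10) (c [1, 1, 3] / 10)
      (c [1, 2, 2] / 15) (c [1, 1, 1, 2] / 10)" for c
  define z :: "nat list \<Rightarrow> 'k" where
    "z = (\<lambda>_. 0)([5] := of_nat n - 14, [1, 4] := 5, [2, 3] := 10, [1, 1, 3] := 20)"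
  show ?thesis
  proof (rule generic_in_symmetric_formsI[of f z])
    show "polynomial_fun f"
      unfolding f_def quintic_degeneracy_def two_node_degeneracy_def by (intro polynomial_intros)
    have "f z = two_node_degeneracy 2 0 2 0"
      by (simp add: f_def quintic_degeneracy_def z_def)
    then show "f z \<noteq> 0"
      by (simp add: two_node_degeneracy_def)
  next
    fix c assume "f c \<noteq> 0"
    then have "quintic_degeneracy (of_nat n) (\<iota> (c [5])) (\<iota> (c [1, 4] / 5)) (\<iota> (c [2, 3] / 10))
      (\<iota> (c [1, 1, 3] / 10)) (\<iota> (c [1, 2, 2] / 15)) (\<iota> (c [1, 1, 1, 2] / 10)) \<noteq> 0"
      unfolding f_def by (simp add: \<iota>_eq_0_iff flip: \<iota>.quintic_degeneracy \<iota>.of_nat)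
    moreover have "(2 :: 'K) \<noteq> 0"
      using \<iota>_eq_0_iff[of 2] by (simp add: \<iota>.numeral)
    ultimately have "\<exists>w s w' s' t u. power_sum_combination n 5 (\<lambda>ks. \<iota> (c ks)) =
      vertex_form n 5 w s + vertex_form n 5 w' s' + edge_form n 5 (\<iota> (c [2, 3] / 10)) t +
      center_form n 5 u"
      by (intro power_sum_combination_5_eq_orbit_forms) (simp_all flip: \<iota>.mult \<iota>.numeral)
    then show "waring_rank n 5 (extend_scalars \<iota> (power_sum_combination n 5 c))
      \<le> enat ((n + 2) choose 2)"
      using waring_rank_quintic_orbit_forms_le
      by (auto simp only: extend_scalars_power_sum_combination[OF hom])
  qed
qed

theorem proposition5p1:
  fixes \<iota> :: "'k::field_char_0 \<Rightarrow> 'K::alg_closed_field"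
    and n :: nat
  assumes "field_embedding \<iota>"
  shows "generic_in (symmetric_forms n 4 :: (nat, 'k) mpoly set)
           (\<lambda>F. waring_rank n 4 (extend_scalars \<iota> F) \<le> enat (((n + 1) choose 2) + 1))
       \<and> int (((n + 1) choose 2) + 1) = int ((n + 2) choose 2) - int n
       \<and> generic_in (symmetric_forms n 5 :: (nat, 'k) mpoly set)
           (\<lambda>F. waring_rank n 5 (extend_scalars \<iota> F) \<le> enat ((n + 2) choose 2))"
proof (intro conjI)
  show "int (((n + 1) choose 2) + 1) = int ((n + 2) choose 2) - int n"
    by (simp add: numeral_2_eq_2)
qed (rule generic_symmetric_quartic[OF assms] generic_symmetric_quintic[OF assms])+

end
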